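(* The class of $Y$-free chordal bipartite graphs is factorial.
   Context: All graphs are finite and simple. $G$ is $H$-free if it has no induced subgraph isomorphic to $H$. $Y$ is the 7-vertex graph that is the disjoint union of a cycle $C_4$ and a path $P_3$ on three vertices. A bipartite graph is chordal bipartite if it has no induced cycles of length at least $6$. A hereditary class (closed under taking induced subgraphs) is factorial if the number of labelled graphs in it on vertex set $\{1,\dots,n\}$ is $2^{\Theta(n\log n)}$. *)

theory Defs
  imports
    Complex_Main
    "HOL-Library.Landau_Symbols"
    "Graph_Theory.Graph_Theory"
begin

text \<open>
  A finite simple undirected graph is a \<^locale>\<open>pair_graph\<close>: a finite vertex set together
  with a symmetric, irreflexive set of arcs (so an edge \<open>uv\<close> is the pair of arcs
  \<open>(u,v)\<close>, \<open>(v,u)\<close>). The notions \<^const>\<open>induced_subgraph\<close> and \<^const>\<open>digraph_iso\<close> live on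
  general digraphs and are reached through \<^const>\<open>with_proj\<close>.
\<close>

definition path_graph :: "nat \<Rightarrow> nat pair_pre_digraph" where
  "path_graph k = \<lparr> pverts = {0..<k},
     parcs = {(u, v). u < k \<and> v < k \<and> (v = Suc u \<or> u = Suc v)} \<rparr>"

text \<open>Meaningful as a cycle only for \<open>k \<ge> 3\<close>.\<close>

definition cycle_graph :: "nat \<Rightarrow> nat pair_pre_digraph" where
  "cycle_graph k = \<lparr> pverts = {0..<k},
     parcs = {(u, v). u < k \<and> v < k \<and> (v = Suc u mod k \<or> u = Suc v mod k)} \<rparr>"

definition disjoint_union_graph ::
    "'a pair_pre_digraph \<Rightarrow> 'b pair_pre_digraph \<Rightarrow> ('a + 'b) pair_pre_digraph" where
  "disjoint_union_graph G H = \<lparr> pverts = pverts G <+> pverts H,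
     parcs = map_prod Inl Inl ` parcs G \<union> map_prod Inr Inr ` parcs H \<rparr>"

definition Y_graph :: "(nat + nat) pair_pre_digraph" where
  "Y_graph = disjoint_union_graph (cycle_graph 4) (path_graph 3)"

definition induced_free :: "'b pair_pre_digraph \<Rightarrow> 'a pair_pre_digraph \<Rightarrow> bool" where
  "induced_free H G \<longleftrightarrow>
     \<not> (\<exists>K :: 'a pair_pre_digraph.
          induced_subgraph (with_proj K) (with_proj G) \<and> digraph_iso (with_proj K) (with_proj H))"

definition bipartite_graph :: "'a pair_pre_digraph \<Rightarrow> bool" where
  "bipartite_graph G \<longleftrightarrow> pair_graph G \<and>
     (\<exists>A B. pverts G = A \<union> B \<and> A \<inter> B = {} \<and> parcs G \<subseteq> A \<times> B \<union> B \<times> A)"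

definition chordal_bipartite :: "'a pair_pre_digraph \<Rightarrow> bool" where
  "chordal_bipartite G \<longleftrightarrow> bipartite_graph G \<and> (\<forall>k\<ge>6. induced_free (cycle_graph k) G)"

text \<open>
  A class of graphs is represented by its members whose vertices are natural numbers; as every
  finite graph is isomorphic to one of these, nothing is lost. Closure under isomorphism is
  implicit in the usual notion of a graph class and is spelled out here.
\<close>

definition hereditary_class :: "nat pair_pre_digraph set \<Rightarrow> bool" where
  "hereditary_class \<C> \<longleftrightarrow>
     (\<forall>G\<in>\<C>. pair_graph G) \<and>
     (\<forall>G\<in>\<C>. \<forall>H. digraph_iso (with_proj G) (with_proj H) \<longrightarrow> H \<in> \<C>) \<and>
     (\<forall>G\<in>\<C>. \<forall>H. induced_subgraph (with_proj H) (with_proj G) \<longrightarrow> H \<in> \<C>)"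

definition labelled_graphs :: "nat pair_pre_digraph set \<Rightarrow> nat \<Rightarrow> nat pair_pre_digraph set" where
  "labelled_graphs \<C> n = {G \<in> \<C>. pverts G = {1..n}}"

definition factorial_class :: "nat pair_pre_digraph set \<Rightarrow> bool" where
  "factorial_class \<C> \<longleftrightarrow> hereditary_class \<C> \<and>
     (\<exists>g :: nat \<Rightarrow> real. g \<in> \<Theta>(\<lambda>n. real n * log 2 (real n)) \<and>
        (\<forall>\<^sub>F n in sequentially. real (card (labelled_graphs \<C> n)) = 2 powr g n))"

lemma pair_graph_path_graph: "pair_graph (path_graph k)"
proof -
  have "finite (parcs (path_graph k))"
    by (rule finite_subset[of _ "{0..<k} \<times> {0..<k}"]) (auto simp: path_graph_def)
  then show ?thesis
    by unfold_locales (auto simp: path_graph_def symmetric_def intro!: symI)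
qed

lemma pair_graph_cycle_graph:
  assumes "k \<ge> 3"
  shows "pair_graph (cycle_graph k)"
proof -
  have "finite (parcs (cycle_graph k))"
    by (rule finite_subset[of _ "{0..<k} \<times> {0..<k}"]) (auto simp: cycle_graph_def)
  moreover have "u \<noteq> Suc u mod k" "Suc u mod k \<noteq> u" if "u < k" for u
    using that assms by (cases "Suc u = k"; simp)+
  ultimately show ?thesis
    by unfold_locales (auto simp: cycle_graph_def symmetric_def intro!: symI)
qed

lemma pair_graph_disjoint_union_graph:
  assumes "pair_graph G" "pair_graph H"
  shows "pair_graph (disjoint_union_graph G H)"
proof -
  interpret G: pair_graph G by fact
  interpret H: pair_graph H by fact
  have "sym (parcs G)" "sym (parcs H)"
    using G.pair_sym_arcs H.pair_sym_arcs by (auto simp: symmetric_def)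
  then have "sym (parcs (disjoint_union_graph G H))"
    unfolding disjoint_union_graph_def sym_def by (auto simp: image_iff) force+
  then show ?thesis
    using G.pair_finite_verts H.pair_finite_verts G.pair_finite_arcs H.pair_finite_arcs
      G.pair_no_loops H.pair_no_loops G.wellformed' H.wellformed'
    by unfold_locales (fastforce simp: disjoint_union_graph_def symmetric_def)+
qed

lemma pair_graph_Y_graph: "pair_graph Y_graph"
  by (simp add: Y_graph_def pair_graph_disjoint_union_graph pair_graph_cycle_graph
      pair_graph_path_graph)

lemma card_Y_graph: "card (pverts Y_graph) = 7"
  by (simp add: Y_graph_def disjoint_union_graph_def cycle_graph_def path_graph_def card_Plus)

end

theory Submission
  imports Defs
begin

text \<open>
  Let \<open>A\<close>, \<open>B\<close> be the colour classes of a \<open>Y\<close>-free chordal bipartite graph, and call a vertex of \<open>A\<close> a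
  nest point if the neighbourhoods of its neighbours form a chain. Suppose that every vertex of \<open>A\<close> has
  degree at least 4 and that no vertex of \<open>B\<close> is complete to \<open>A\<close>. Among all nest points \<open>z\<close> and
  neighbours \<open>c \<noteq> d\<close> of \<open>z\<close> with \<open>N(c) \<subseteq> N(d)\<close> choose those with \<open>|N(c)|\<close> maximal, and let \<open>w\<close> be a nest
  point outside the largest neighbourhood of a neighbour of \<open>z\<close>. By \<open>Y\<close>-freeness all neighbours \<open>t\<close> of \<open>w\<close>
  but the lowest one in the chain satisfy \<open>N(t) \<supseteq> (N(c) - {z}) \<union> {w}\<close>, and by maximality this is an
  equality for all but the lowest and the highest one. So two neighbours of \<open>w\<close> are twins.
  Hence every graph in the class has a vertex that can be deleted and restored from \<open>O(log n)\<close> bits,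
  which bounds the number of labelled graphs by \<open>n\<^bsup>O(n)\<^esup>\<close>. For the lower bound, forests of stars whose
  leaves \<open>m+1..2m\<close> choose their centres freely among \<open>1..m\<close> give \<open>m\<^bsup>m\<^esup>\<close> graphs.
\<close>

subsection \<open>Nest points\<close>

text \<open>The bipartite relation is treated as a hypergraph on the points \<open>A\<close> whose
  edges are the elements of \<open>B\<close>; distinct edges may have the same point set.\<close>

definition nbhd :: "'a set \<Rightarrow> ('a \<Rightarrow> 'b \<Rightarrow> bool) \<Rightarrow> 'b \<Rightarrow> 'a set" where
  "nbhd A E b = {a \<in> A. E a b}"

text \<open>An induced cycle \<open>b 0\<close>, \<open>a 0\<close>, \<open>b 1\<close>,
  \<open>a 1\<close>, ... of length 2n. Injectivity of \<open>a\<close> and \<open>b\<close> is left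
  out, since for n \<ge> 3 the adjacencies force it (\<open>hole_inj\<close>).\<close>

definition hole :: "'a set \<Rightarrow> 'b set \<Rightarrow> ('a \<Rightarrow> 'b \<Rightarrow> bool) \<Rightarrow> nat \<Rightarrow> (nat \<Rightarrow> 'a) \<Rightarrow> (nat \<Rightarrow> 'b) \<Rightarrow> bool"
  where "hole A B E n a b \<longleftrightarrow> (\<forall>i<n. a i \<in> A \<and> b i \<in> B) \<and>
     (\<forall>i<n. \<forall>j<n. E (a i) (b j) \<longleftrightarrow> j = i \<or> j = Suc i mod n)"

definition hole_free :: "'a set \<Rightarrow> 'b set \<Rightarrow> ('a \<Rightarrow> 'b \<Rightarrow> bool) \<Rightarrow> bool" where
  "hole_free A B E \<longleftrightarrow> (\<forall>n\<ge>3. \<forall>a b. \<not> hole A B E n a b)"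

definition nest_point :: "'a set \<Rightarrow> 'b set \<Rightarrow> ('a \<Rightarrow> 'b \<Rightarrow> bool) \<Rightarrow> 'a \<Rightarrow> bool" where
  "nest_point A B E w \<longleftrightarrow> w \<in> A \<and> (\<forall>b\<in>B. \<forall>b'\<in>B. E w b \<longrightarrow> E w b' \<longrightarrow>
     nbhd A E b \<subseteq> nbhd A E b' \<or> nbhd A E b' \<subseteq> nbhd A E b)"

lemma hole_free_mono:
  assumes "hole_free A B E" "A' \<subseteq> A" "B' \<subseteq> B"
  shows "hole_free A' B' E"
proof -
  have "hole A' B' E n a b \<Longrightarrow> hole A B E n a b" for n a b
    using assms(2,3) unfolding hole_def by blast
  then show ?thesis using assms(1) unfolding hole_free_def by blast
qed

text \<open>
  The existence of a nest point outside any given edge is due to Brouwer and Kolen. Points of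
  \<open>N e\<close> that lie on no edge meeting the component \<open>K\<close> can be deleted; if there are none, a shortest
  path inside \<open>K\<close>, from an edge \<open>F\<close> with largest trace on \<open>N e\<close> to an edge whose trace is not contained
  in that of \<open>F\<close>, closes up through \<open>e\<close> to a hole.
\<close>

lemma nest_point_outside_edge:
  assumes "finite A" "hole_free A B E" "e \<in> B" "\<not> A \<subseteq> nbhd A E e"
  shows "\<exists>w. w \<notin> nbhd A E e \<and> nest_point A B E w"
  using assms
proof (induction A arbitrary: e rule: finite_psubset_induct)
  case (psubset A e0)
  define N where "N = nbhd A E"
  \<comment> \<open>Edges containing all of \<open>A\<close> are comparable with every edge, so only
    the others matter for nest points.\<close>
  define B' where "B' = {b \<in> B. \<not> A \<subseteq> N b}"
  have NA: "N b \<subseteq> A" for b by (auto simp: N_def nbhd_def)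
  have fin: "finite (N b)" for b using NA psubset.hyps finite_subset by blast
  \<comment> \<open>\<open>e0\<close> is enlarged to an edge \<open>e\<close> with maximal point set
    in \<open>B'\<close>; a point outside \<open>N e\<close> is also outside
    \<open>N e0\<close>.\<close>
  have "e0 \<in> B' \<and> N e0 \<subseteq> N e0" using psubset.prems by (auto simp: B'_def N_def)
  moreover have "card (N b) < Suc (card A)" for b
    using card_mono[OF psubset.hyps NA, of b] by simp
  ultimately obtain e where e: "e \<in> B'" "N e0 \<subseteq> N e"
    and emax: "\<And>b. b \<in> B' \<Longrightarrow> N e0 \<subseteq> N b \<Longrightarrow> card (N b) \<le> card (N e)"
    using ex_has_greatest_nat[of "\<lambda>b. b \<in> B' \<and> N e0 \<subseteq> N b" e0 "\<lambda>b. card (N b)" "Suc (card A)"]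
    by (metis less_imp_le_nat)
  have emax': "N b = N e" if "b \<in> B'" "N e \<subseteq> N b" for b
    using emax[of b] that e card_subset_eq[OF fin] card_mono[OF fin] by (metis le_antisym order_trans)
  from e(1) obtain w0 where w0: "w0 \<in> A" "w0 \<notin> N e" unfolding B'_def by auto
  \<comment> \<open>\<open>KB\<close> and \<open>K\<close> are the edges and points of the component
    of \<open>w0\<close> once \<open>N e\<close> is removed; \<open>A'\<close> adds the points of
    \<open>N e\<close> that lie on an edge of this component.\<close>
  define step where "step = {(b, b'). b \<in> B' \<and> b' \<in> B' \<and> (\<exists>w\<in>A - N e. E w b \<and> E w b')}"
  define KB where "KB = {b. \<exists>b0\<in>B'. E w0 b0 \<and> (b0, b) \<in> step\<^sup>*}"
  define K where "K = {w \<in> A - N e. w = w0 \<or> (\<exists>b\<in>KB. E w b)}"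
  define A' where "A' = K \<union> {x \<in> N e. \<exists>b\<in>KB. E x b}"
  have sym: "sym step" by (auto simp: step_def sym_def)
  have KB: "b \<in> B' \<and> (\<exists>w\<in>A - N e. E w b)" if "b \<in> KB" for b
  proof -
    from that obtain b0 where b0: "b0 \<in> B'" "E w0 b0" "(b0, b) \<in> step\<^sup>*" by (auto simp: KB_def)
    from b0(3) show ?thesis
      by (cases rule: rtranclE) (use b0 w0 in \<open>auto simp: step_def\<close>)
  qed
  have KB_step: "b' \<in> KB" if "b \<in> KB" "(b, b') \<in> step\<^sup>*" for b b'
    using that by (auto simp: KB_def intro: rtrancl_trans)
  have KB_conn: "(b, b') \<in> step\<^sup>*" if "b \<in> KB" "b' \<in> KB" for b b'
  proof -
    from that obtain b0 b1 where *: "b0 \<in> B'" "E w0 b0" "(b0, b) \<in> step\<^sup>*"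
      "b1 \<in> B'" "E w0 b1" "(b1, b') \<in> step\<^sup>*" by (auto simp: KB_def)
    then have "(b0, b1) \<in> step" using w0 by (auto simp: step_def)
    with * show ?thesis using sym_rtrancl[OF sym]
      by (meson rtrancl.rtrancl_into_rtrancl rtrancl_trans symD)
  qed
  have K_KB: "b \<in> KB" if "k \<in> K" "b \<in> B'" "E k b" for k b
  proof (cases "k = w0")
    case True then show ?thesis using that by (auto simp: KB_def)
  next
    case False
    with that(1) obtain b1 where b1: "b1 \<in> KB" "E k b1" by (auto simp: K_def)
    have "(b1, b) \<in> step" using that b1 KB[of b1] by (auto simp: step_def K_def)
    with b1 show ?thesis using KB_step by blast
  qed
  have N_KB: "N b \<subseteq> A'" if "b \<in> KB" for b
    using that NA by (auto simp: A'_def K_def N_def nbhd_def)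
  have A'A: "A' \<subseteq> A" using NA by (auto simp: A'_def K_def)
  \<comment> \<open>An edge through a point of \<open>K\<close> is in \<open>KB\<close> or covers
    \<open>A\<close>, so only pairs from \<open>KB\<close> need comparing.\<close>
  have nestI: "nest_point A B E k"
    if "k \<in> K" "\<And>b b'. \<lbrakk>b \<in> KB; b' \<in> KB; E k b; E k b'\<rbrakk> \<Longrightarrow> N b \<subseteq> N b' \<or> N b' \<subseteq> N b" for k
    unfolding nest_point_def N_def[symmetric]
  proof (intro conjI ballI impI)
    show "k \<in> A" using that by (auto simp: K_def)
    fix b b' assume b: "b \<in> B" "b' \<in> B" "E k b" "E k b'"
    show "N b \<subseteq> N b' \<or> N b' \<subseteq> N b"
    proof (cases "b \<in> B' \<and> b' \<in> B'")
      case True then show ?thesis using that b K_KB by blast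
    next
      case False
      then have "A \<subseteq> N b \<or> A \<subseteq> N b'" using b by (auto simp: B'_def)
      then show ?thesis using NA by blast
    qed
  qed
  have "\<exists>w\<in>K. nest_point A B E w"
  proof (cases "A' = A")
    case False
    then have ps: "A' \<subset> A" using A'A by auto
    have w0A': "w0 \<in> A'" using w0 by (auto simp: A'_def K_def)
    have N': "nbhd A' E b = N b \<inter> A'" for b using A'A by (auto simp: N_def nbhd_def)
    \<comment> \<open>Edges in \<open>KB\<close> lie entirely inside \<open>A'\<close>, so the chain
      condition that induction gives on \<open>A'\<close> lifts to \<open>A\<close> at points of
      \<open>K\<close>.\<close>
    have "\<exists>w. w \<notin> nbhd A' E e \<and> nest_point A' B E w"
    proof (rule psubset.IH[OF ps])
      show "hole_free A' B E" using psubset.prems(1) A'A by (rule hole_free_mono) auto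
      show "e \<in> B" using e by (auto simp: B'_def)
      show "\<not> A' \<subseteq> nbhd A' E e" using w0 w0A' N' by auto
    qed
    then obtain w where w: "w \<notin> nbhd A' E e" "nest_point A' B E w" by blast
    then have wA': "w \<in> A'" by (auto simp: nest_point_def)
    then have "w \<in> K" using w(1) unfolding N' by (auto simp: A'_def)
    moreover have "nest_point A B E w"
    proof (rule nestI[OF \<open>w \<in> K\<close>])
      fix b b' assume b: "b \<in> KB" "b' \<in> KB" "E w b" "E w b'"
      then have "b \<in> B" "b' \<in> B" using KB by (auto simp: B'_def)
      with w(2) b have "N b \<inter> A' \<subseteq> N b' \<inter> A' \<or> N b' \<inter> A' \<subseteq> N b \<inter> A'"
        unfolding nest_point_def N' by blast
      then show "N b \<subseteq> N b' \<or> N b' \<subseteq> N b" using N_KB b by blast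
    qed
    ultimately show ?thesis by blast
  next
    case True
    have w0K: "w0 \<in> K" using w0 by (auto simp: K_def)
    show ?thesis
    proof (cases "KB = {}")
      case True
      \<comment> \<open>Without edges in \<open>KB\<close> the comparison required at
        \<open>w0\<close> is vacuous.\<close>
      then show ?thesis using nestI[OF w0K] w0K by blast
    next
      case False
      then obtain F0 where "F0 \<in> KB" by auto
      moreover have "card (N b \<inter> N e) < Suc (card A)" for b
        using card_mono[OF psubset.hyps, of "N b \<inter> N e"] NA by (metis inf.coboundedI1 less_Suc_eq_le)
      ultimately obtain F where F: "F \<in> KB"
        and Fmax: "\<And>b. b \<in> KB \<Longrightarrow> card (N b \<inter> N e) \<le> card (N F \<inter> N e)"
        using ex_has_greatest_nat[of "\<lambda>b. b \<in> KB" F0 "\<lambda>b. card (N b \<inter> N e)" "Suc (card A)"]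
        by (metis less_imp_le_nat)
      define Q where "Q = (\<lambda>n. \<exists>b. (F, b) \<in> step ^^ n \<and> \<not> N b \<inter> N e \<subseteq> N F)"
      \<comment> \<open>Otherwise maximality of \<open>e\<close> would force
        \<open>N F = N e\<close>, but \<open>F\<close> has a point outside \<open>N e\<close>. The
        point \<open>x0\<close> found here lies on an edge of \<open>KB\<close> because
        \<open>A' = A\<close>, so \<open>Q\<close> holds somewhere.\<close>
      have "\<not> N e \<subseteq> N F"
        using emax'[of F] KB[OF F] by (auto simp: N_def nbhd_def)
      then obtain x0 where x0: "x0 \<in> N e" "x0 \<notin> N F" by auto
      then have "x0 \<in> A'" "x0 \<notin> K" using True NA by (auto simp: K_def)
      then obtain F1 where F1: "F1 \<in> KB" "E x0 F1" by (auto simp: A'_def)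
      obtain m where "(F, F1) \<in> step ^^ m" using KB_conn[OF F F1(1)] rtrancl_power by blast
      moreover have "x0 \<in> N F1" using x0 F1 NA by (auto simp: N_def nbhd_def)
      ultimately have "Q m" using x0 by (auto simp: Q_def)
      define n where "n = (LEAST n. Q n)"
      have Qn: "Q n" unfolding n_def using \<open>Q m\<close> by (rule LeastI)
      have nQ: "\<not> Q i" if "i < n" for i using that not_less_Least unfolding n_def by blast
      from Qn obtain G x where G: "(F, G) \<in> step ^^ n" "x \<in> N G" "x \<in> N e" "x \<notin> N F"
        by (auto simp: Q_def)
      from G(1) obtain f where f: "f 0 = F" "f n = G" "\<And>i. i < n \<Longrightarrow> (f i, f (Suc i)) \<in> step"
        unfolding relpow_fun_conv by blast
      have f_rel: "(f i, f (i + k)) \<in> step ^^ k" if "i + k \<le> n" for i k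
        unfolding relpow_fun_conv by (rule exI[of _ "\<lambda>j. f (i + j)"]) (use that f(3) in auto)
      have G_KB: "f i \<in> KB" if "i \<le> n" for i
        using KB_step[OF F] f_rel[of 0 i] that f(1) relpow_imp_rtrancl by fastforce
      have "\<forall>i\<in>{..<n}. \<exists>w. w \<in> A - N e \<and> E w (f i) \<and> E w (f (Suc i))"
        using f(3) unfolding step_def by blast
      from bchoice[OF this] obtain w
        where w: "i < n \<Longrightarrow> w i \<in> A - N e \<and> E (w i) (f i) \<and> E (w i) (f (Suc i))" for i
        by blast
      \<comment> \<open>A shortcut from \<open>f i\<close> to \<open>f j\<close> would give a walk
        from \<open>F\<close> to \<open>G\<close> with fewer than \<open>n\<close> steps.\<close>
      have no_short: False if "i \<le> n" "j \<le> n" "(f i, f j) \<in> step" "Suc i < j" for i j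
      proof -
        have "(F, f i) \<in> step ^^ i" "(f j, G) \<in> step ^^ (n - j)"
          using f_rel[of 0 i] f_rel[of j "n - j"] that f by auto
        then have "(F, G) \<in> (step ^^ i) O step O (step ^^ (n - j))"
          using that(3) by blast
        then have "(F, G) \<in> step ^^ (i + (1 + (n - j)))"
          by (simp only: relpow_add relpow_1)
        then have "Q (i + (1 + (n - j)))" using G by (auto simp: Q_def)
        with nQ that show False by simp
      qed
      have wf: "E (w i) (f j) \<longleftrightarrow> j = i \<or> j = Suc i" if "i < n" "j \<le> n" for i j
      proof
        assume Ew: "E (w i) (f j)"
        have st: "(f i, f j) \<in> step" "(f j, f (Suc i)) \<in> step"
          using Ew w[OF that(1)] KB[OF G_KB] that by (auto simp: step_def)
        have "\<not> Suc i < j" using no_short[of i j] st(1) that by auto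
        moreover have "\<not> j < i" using no_short[of j "Suc i"] st(2) that by auto
        ultimately show "j = i \<or> j = Suc i" by linarith
      qed (use w that in auto)
      have xf: "x \<notin> N (f i)" if "i < n" for i
        using nQ[OF that] f_rel[of 0 i] f(1) that G by (auto simp: Q_def)
      \<comment> \<open>Otherwise the trace of \<open>G\<close>, which also contains
        \<open>x\<close>, would be larger than the maximal trace of \<open>F\<close>.\<close>
      have "\<not> N F \<inter> N e \<subseteq> N G"
      proof
        assume "N F \<inter> N e \<subseteq> N G"
        then have "N F \<inter> N e \<subset> N G \<inter> N e" using G by auto
        then have "card (N F \<inter> N e) < card (N G \<inter> N e)" using fin by (simp add: psubset_card_mono)
        then show False using Fmax[of G] G_KB[of n] f by auto
      qed
      then obtain y where y: "y \<in> N F" "y \<in> N e" "y \<notin> N G" by auto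
      \<comment> \<open>The last edge of the path through \<open>y\<close>: all later edges miss
        \<open>y\<close>, so the hole can start at \<open>f p\<close>.\<close>
      define p where "p = (GREATEST i. i \<le> n \<and> y \<in> N (f i))"
      have p: "p \<le> n \<and> y \<in> N (f p)" unfolding p_def
        by (rule GreatestI_nat[where k=0 and b=n]) (use y f in auto)
      have p': "i \<le> p" if "i \<le> n" "y \<in> N (f i)" for i
        unfolding p_def by (rule Greatest_le_nat[where b=n]) (use that in auto)
      have "p < n" using p y f by (metis le_neq_implies_less)
      define m where "m = n - p"
      \<comment> \<open>The hole has points \<open>y\<close>, \<open>w p\<close>, ...,
        \<open>w (n - 1)\<close>, \<open>x\<close> and edges \<open>e\<close>, \<open>f p\<close>,
        ..., \<open>f n\<close>. Index 0 is reserved for \<open>y\<close> and \<open>e\<close>,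
        hence the shift by one; \<open>x\<close> joins \<open>f n = G\<close> back to
        \<open>e\<close>.\<close>
      define a where "a = (\<lambda>i. if i = 0 then y else if i \<le> m then w (p + i - 1) else x)"
      define b where "b = (\<lambda>i. if i = 0 then e else f (p + i - 1))"
      have m: "m \<ge> 1" "p + m = n" using \<open>p < n\<close> by (auto simp: m_def)
      have NE: "E z c \<longleftrightarrow> z \<in> N c" if "z \<in> A" for z c using that by (auto simp: N_def nbhd_def)
      have yA: "y \<in> A" and xA: "x \<in> A" using y G NA by auto
      have "\<forall>i<m+2. a i \<in> A \<and> b i \<in> B"
      proof (intro allI impI conjI)
        fix i assume i: "i < m + 2"
        show "a i \<in> A" using w[of "p + i - 1"] i m yA xA by (auto simp: a_def)
        show "b i \<in> B" using e KB[OF G_KB[of "p + i - 1"]] i m by (auto simp: b_def B'_def)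
      qed
      moreover have "E (a i) (b j) \<longleftrightarrow> j = i \<or> j = Suc i mod (m + 2)"
        if ij: "i < m + 2" "j < m + 2" for i j
      proof -
        consider "i = 0" | "1 \<le> i" "i \<le> m" | "i = m + 1" using ij by linarith
        then show ?thesis
        proof cases
          case 1
          then have *: "E (a i) (b j) \<longleftrightarrow> y \<in> N (b j)" using NE yA by (simp add: a_def)
          consider "j = 0" | "j = 1" | "j > 1" by linarith
          then show ?thesis
          proof cases
            case 3
            then obtain k where k: "j = Suc (Suc k)" by (auto dest: less_imp_Suc_add)
            then have "y \<notin> N (f (Suc (p + k)))" using p'[of "Suc (p + k)"] ij m by auto
            then show ?thesis unfolding * using k 1 by (auto simp: b_def)
          qed (use 1 y p in \<open>unfold *, auto simp: b_def\<close>)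
        next
          case 2
          then have *: "Suc i mod (m + 2) = Suc i" "a i = w (p + i - 1)" "p + i - 1 < n"
            using m by (auto simp: a_def)
          show ?thesis
          proof (cases "j = 0")
            case True
            then show ?thesis using 2 w[OF *(3)] NE by (auto simp: * b_def)
          next
            case False
            then show ?thesis using wf[OF *(3), of "p + j - 1"] 2 ij m by (auto simp: * b_def)
          qed
        next
          case 3
          then have *: "E (a i) (b j) \<longleftrightarrow> x \<in> N (b j)" using NE xA by (simp add: a_def)
          consider "j = 0" | "j = m + 1" | "0 < j" "j < m + 1" using ij by linarith
          then show ?thesis
          proof cases
            case 3
            then show ?thesis using xf[of "p + j - 1"] \<open>i = m + 1\<close> m unfolding * by (auto simp: b_def)
          qed (use 3 G m f in \<open>unfold *, auto simp: b_def\<close>)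
        qed
      qed
      moreover have "m + 2 \<ge> 3" using m by simp
      ultimately have "\<not> hole_free A B E" unfolding hole_free_def hole_def by blast
      with psubset.prems show ?thesis by blast
    qed
  qed
  then obtain w where "w \<in> K" "nest_point A B E w" by blast
  moreover then have "w \<notin> N e0" using e by (auto simp: K_def)
  ultimately show ?case unfolding N_def by blast
qed

section \<open>Twins in the absence of \<open>Y\<close>\<close>

text \<open>Describes the copies of \<open>Y\<close> with 4-cycle \<open>x c z d\<close> and path
  \<open>t w t'\<close>, the middle vertex \<open>w\<close> being in \<open>A\<close>. The other
  distinctness conditions follow from the non-adjacencies: \<open>c = t\<close>, for instance, would
  make \<open>E x t\<close> true.\<close>

definition c4_p3_free :: "'a set \<Rightarrow> 'b set \<Rightarrow> ('a \<Rightarrow> 'b \<Rightarrow> bool) \<Rightarrow> bool" where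
  "c4_p3_free A B E \<longleftrightarrow> (\<forall>x\<in>A. \<forall>z\<in>A. \<forall>w\<in>A. \<forall>c\<in>B. \<forall>d\<in>B. \<forall>t\<in>B. \<forall>t'\<in>B.
     x \<noteq> z \<longrightarrow> c \<noteq> d \<longrightarrow> t \<noteq> t' \<longrightarrow> E x c \<longrightarrow> E x d \<longrightarrow> E z c \<longrightarrow> E z d \<longrightarrow> E w t \<longrightarrow> E w t' \<longrightarrow>
     E w c \<or> E w d \<or> E x t \<or> E x t' \<or> E z t \<or> E z t')"

lemma c4_p3_free_mono:
  assumes "c4_p3_free A B E" "A' \<subseteq> A" "B' \<subseteq> B"
  shows "c4_p3_free A' B' E"
  unfolding c4_p3_free_def
  by (intro ballI impI, rule assms(1)[unfolded c4_p3_free_def, rule_format])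
    (use assms(2,3) in blast)+

text \<open>Degree at least four leaves two neighbours of a suitable nest point after the lowest and
  the highest of its chain are removed; an extremal choice forces both to have the same
  neighbourhood.\<close>

lemma low_degree_or_dominating_or_twins:
  assumes fin: "finite A" "finite B" and "A \<noteq> {}"
    and hf: "hole_free A B E" and yf: "c4_p3_free A B E"
    and deg: "\<And>w. w \<in> A \<Longrightarrow> card {b \<in> B. E w b} > 3"
    and dom: "\<And>b. b \<in> B \<Longrightarrow> \<not> A \<subseteq> nbhd A E b"
  obtains b b' where "b \<in> B" "b' \<in> B" "b \<noteq> b'" "nbhd A E b = nbhd A E b'"
proof -
  define N where "N = nbhd A E"
  define T where "T = (\<lambda>w. {b \<in> B. E w b})"
  have NA: "N b \<subseteq> A" for b by (auto simp: N_def nbhd_def)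
  have finN: "finite (N b)" for b using NA fin finite_subset by blast
  have finT: "finite (T w)" for w using fin by (simp add: T_def)
  have NE: "z \<in> N b \<longleftrightarrow> E z b" if "z \<in> A" for z b using that by (auto simp: N_def nbhd_def)
  have TB: "T w \<subseteq> B" for w by (auto simp: T_def)
  have nest: "N b \<subseteq> N b' \<or> N b' \<subseteq> N b" if "nest_point A B E w" "b \<in> T w" "b' \<in> T w" for w b b'
    using that unfolding nest_point_def T_def N_def by blast
  have T_ne: "T w \<noteq> {}" if "nest_point A B E w" for w
  proof -
    have "card (T w) > 3" using deg that by (simp add: T_def nest_point_def)
    then show ?thesis by auto
  qed
  have top: "\<exists>d\<in>T w. \<forall>b\<in>T w. N b \<subseteq> N d" if w: "nest_point A B E w" for w
  proof -
    have "Max ((\<lambda>b. card (N b)) ` T w) \<in> (\<lambda>b. card (N b)) ` T w"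
      using finT T_ne[OF w] by (intro Max_in) auto
    then obtain d where d: "d \<in> T w" "card (N d) = Max ((\<lambda>b. card (N b)) ` T w)" by auto
    have "card (N b) \<le> card (N d)" if "b \<in> T w" for b
      unfolding d(2) using finT that by (intro Max_ge) auto
    then show ?thesis using d(1) nest[OF w] card_seteq[OF finN] by (metis order_refl)
  qed
  have bottom: "\<exists>d\<in>T w. \<forall>b\<in>T w. N d \<subseteq> N b" if w: "nest_point A B E w" for w
  proof -
    have "Min ((\<lambda>b. card (N b)) ` T w) \<in> (\<lambda>b. card (N b)) ` T w"
      using finT T_ne[OF w] by (intro Min_in) auto
    then obtain d where d: "d \<in> T w" "card (N d) = Min ((\<lambda>b. card (N b)) ` T w)" by auto
    have "card (N d) \<le> card (N b)" if "b \<in> T w" for b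
      unfolding d(2) using finT that by (intro Min_le) auto
    then show ?thesis using d(1) nest[OF w] card_seteq[OF finN] by (metis order_refl)
  qed
  \<comment> \<open>\<open>t1\<close> and \<open>t4\<close> may coincide; in either case more than
    three neighbours leave at least two.\<close>
  have two: "\<exists>t2\<in>T w - {t1, t4}. \<exists>t3\<in>T w - {t1, t4}. t2 \<noteq> t3" if "w \<in> A" for w t1 t4
  proof -
    have "card {t1, t4} \<le> 2" by (simp add: card_insert_if)
    then have "card (T w - {t1, t4}) \<ge> 2"
      using deg[OF that] diff_card_le_card_Diff[of "{t1, t4}" "T w"] by (simp add: T_def)
    then obtain X where "X \<subseteq> T w - {t1, t4}" "card X = 2" by (rule obtain_subset_with_card_n)
    then show ?thesis unfolding card_2_iff by blast
  qed
  \<comment> \<open>\<open>p = (z, c, d)\<close> maximizes the size of \<open>N c\<close>, the smaller of two nested neighbourhoods at a nest point.\<close>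
  define P where "P = (\<lambda>(z, c, d). nest_point A B E z \<and> c \<in> T z \<and> d \<in> T z \<and> c \<noteq> d \<and> N c \<subseteq> N d)"
  obtain a0 where "a0 \<in> A" using assms by auto
  then obtain e where "e \<in> T a0" using two by blast
  \<comment> \<open>Any edge serves here: it does not cover \<open>A\<close>, so some nest point
    lies outside it.\<close>
  then obtain z0 where z0: "nest_point A B E z0"
    using nest_point_outside_edge[OF fin(1) hf _ dom] TB by blast
  then obtain c0 d0 where "c0 \<in> T z0" "d0 \<in> T z0" "c0 \<noteq> d0" using two unfolding nest_point_def by blast
  then have "\<exists>p. P p" using nest[OF z0] z0 unfolding P_def by blast
  moreover have "card (N c) < Suc (card A)" for c using card_mono[OF fin(1) NA] by (simp add: less_Suc_eq_le)
  ultimately obtain p where p: "P p" "\<And>q. P q \<Longrightarrow> card (N (fst (snd q))) \<le> card (N (fst (snd p)))"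
    using ex_has_greatest_nat[of P _ "\<lambda>q. card (N (fst (snd q)))" "Suc (card A)"]
    by (metis less_imp_le_nat)
  obtain z c d where pz: "p = (z, c, d)" by (cases p)
  have z: "nest_point A B E z" "c \<in> T z" "d \<in> T z" "c \<noteq> d" "N c \<subseteq> N d" and zA: "z \<in> A"
    using p(1) by (auto simp: P_def pz nest_point_def)
  have pmax: "card (N t) \<le> card (N c)" if "nest_point A B E w" "t \<in> T w" "t' \<in> T w" "t \<noteq> t'" "N t \<subseteq> N t'"
    for w t t' using p(2)[of "(w, t, t')"] that by (simp add: P_def pz)
  obtain d' where d': "d' \<in> T z" "\<And>b. b \<in> T z \<Longrightarrow> N b \<subseteq> N d'" using top[OF z(1)] by blast
  obtain w where w: "w \<notin> N d'" "nest_point A B E w"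
    using nest_point_outside_edge[OF fin(1) hf _ dom, of d'] d' TB unfolding N_def by blast
  have wA: "w \<in> A" using w by (auto simp: nest_point_def)
  \<comment> \<open>\<open>N d'\<close> contains the neighbourhood of every neighbour of
    \<open>z\<close>, so \<open>w\<close> and \<open>z\<close> have no common neighbour.\<close>
  have w_not: "\<not> E w b" if "b \<in> T z" for b using d'(2)[OF that] w(1) NE[OF wA] by blast
  \<comment> \<open>Otherwise the 4-cycle \<open>x c z d\<close> and the path \<open>t w t'\<close> induce a copy of \<open>Y\<close>.\<close>
  have sub: "N c - {z} \<subseteq> N t'" if t: "t \<in> T w" "t' \<in> T w" "t \<noteq> t'" "N t \<subseteq> N t'" for t t'
  proof
    fix x assume x: "x \<in> N c - {z}"
    show "x \<in> N t'"
    proof (rule ccontr)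
      assume xt': "x \<notin> N t'"
      have xA: "x \<in> A" using x NA by blast
      have "E x c" "E x d" "\<not> E x t" "\<not> E x t'" using x xt' t(4) z(5) NE[OF xA] by blast+
      moreover have "E z c" "E z d" "E w t" "E w t'" "c \<in> B" "d \<in> B" "t \<in> B" "t' \<in> B"
        using z t by (auto simp: T_def)
      moreover have "\<not> E z t" "\<not> E z t'" using w_not t by (auto simp: T_def)
      moreover have "\<not> E w c" "\<not> E w d" "x \<noteq> z" using w_not z x by blast+
      ultimately show False using yf xA zA wA z(4) t(3) unfolding c4_p3_free_def by blast
    qed
  qed
  obtain t1 where t1: "t1 \<in> T w" "\<And>b. b \<in> T w \<Longrightarrow> N t1 \<subseteq> N b" using bottom[OF w(2)] by blast
  obtain t4 where t4: "t4 \<in> T w" "\<And>b. b \<in> T w \<Longrightarrow> N b \<subseteq> N t4" using top[OF w(2)] by blast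
  obtain t2 t3 where t23: "t2 \<in> T w - {t1, t4}" "t3 \<in> T w - {t1, t4}" "t2 \<noteq> t3" using two[OF wA] by blast
  have "insert w (N c - {z}) = N t" if t: "t \<in> T w - {t1, t4}" for t
  proof (rule card_seteq[OF finN])
    show "insert w (N c - {z}) \<subseteq> N t"
      using sub[of t1 t] t1 t NE[OF wA] by (auto simp: T_def)
    \<comment> \<open>Exchanging \<open>z\<close> for \<open>w\<close> keeps the size |N c|, and
      \<open>t\<close>, being the lower of \<open>t\<close> and \<open>t4\<close>, has |N t| \<le>
      |N c| by the extremal choice.\<close>
    have "z \<in> N c" "w \<notin> N c" using z(2) NE zA wA w_not by (auto simp: T_def)
    then have "card (insert w (N c - {z})) = card (N c)"
      using finN by (metis Diff_iff card.remove card_insert_disjoint finite_Diff)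
    then show "card (N t) \<le> card (insert w (N c - {z}))"
      using pmax[OF w(2), of t t4] t t4 by simp
  qed
  from this[OF t23(1)] this[OF t23(2)] have "N t2 = N t3" by simp
  then show ?thesis using that[of t2 t3] t23 TB unfolding N_def by blast
qed

subsection \<open>Counting by vertex deletion\<close>

definition nbrs :: "('a \<times> 'a) set \<Rightarrow> 'a \<Rightarrow> 'a set" where
  "nbrs R v = {u. (v, u) \<in> R \<or> (u, v) \<in> R}"

text \<open>
  A bipartite graph on \<open>V\<close> is coded by one colour class \<open>A\<close> and its arcs \<open>R\<close> directed away from \<open>A\<close>.
\<close>

definition coded_graphs :: "'a set \<Rightarrow> ('a set \<times> ('a \<times> 'a) set) set" where
  "coded_graphs V = {(A, R). A \<subseteq> V \<and> R \<subseteq> A \<times> (V - A) \<and>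
     hole_free A (V - A) (\<lambda>a b. (a, b) \<in> R) \<and> c4_p3_free A (V - A) (\<lambda>a b. (a, b) \<in> R)}"

text \<open>Neighbourhoods a deleted vertex may have had, read off the remaining graph: a vertex of
  low degree, a vertex complete to the class \<open>fst p\<close>, or a twin of a remaining
  vertex.\<close>

definition candidates :: "'a set \<Rightarrow> 'a set \<times> ('a \<times> 'a) set \<Rightarrow> 'a set set" where
  "candidates V p = {X. X \<subseteq> V \<and> card X \<le> 3} \<union> {fst p} \<union> nbrs (snd p) ` V"

definition delete_vertex :: "'a \<Rightarrow> 'a set \<times> ('a \<times> 'a) set \<Rightarrow> 'a set \<times> ('a \<times> 'a) set" where
  "delete_vertex v p = (fst p - {v}, snd p \<inter> (- {v}) \<times> (- {v}))"

text \<open>The flag \<open>s\<close> says whether \<open>v\<close> joins the coded colour class,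
  which fixes the direction of the new arcs.\<close>

definition insert_vertex :: "'a \<Rightarrow> bool \<Rightarrow> 'a set \<Rightarrow> 'a set \<times> ('a \<times> 'a) set \<Rightarrow> 'a set \<times> ('a \<times> 'a) set" where
  "insert_vertex v s X p = (if s then (insert v (fst p), snd p \<union> {v} \<times> X) else (fst p, snd p \<union> X \<times> {v}))"

lemma finite_coded_graphs: "finite V \<Longrightarrow> finite (coded_graphs V)"
  by (rule finite_subset[of _ "Pow V \<times> Pow (V \<times> V)"]) (auto simp: coded_graphs_def)

lemma hole_free_cong:
  "hole_free A B E = hole_free A B E'" if "\<And>a b. a \<in> A \<Longrightarrow> b \<in> B \<Longrightarrow> E a b = E' a b"
proof -
  have "hole A B E n a b = hole A B E' n a b" for n a b
    unfolding hole_def by (intro conj_cong refl all_cong) (simp add: that)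
  then show ?thesis by (simp add: hole_free_def)
qed

lemma delete_vertex_in_coded_graphs:
  assumes "p \<in> coded_graphs V"
  shows "delete_vertex v p \<in> coded_graphs (V - {v})"
proof -
  obtain A R where p: "p = (A, R)" by (cases p)
  define R' where "R' = R \<inter> (- {v}) \<times> (- {v})"
  have *: "A \<subseteq> V" "R \<subseteq> A \<times> (V - A)" "hole_free A (V - A) (\<lambda>a b. (a, b) \<in> R)"
    "c4_p3_free A (V - A) (\<lambda>a b. (a, b) \<in> R)" using assms by (auto simp: p coded_graphs_def)
  have sub: "A - {v} \<subseteq> A" "V - {v} - (A - {v}) \<subseteq> V - A" by auto
  have eq: "((a, b) \<in> R) = ((a, b) \<in> R')" if "a \<in> A - {v}" "b \<in> V - {v} - (A - {v})" for a b
    using that by (auto simp: R'_def)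
  have "hole_free (A - {v}) (V - {v} - (A - {v})) (\<lambda>a b. (a, b) \<in> R')"
    using hole_free_mono[OF *(3) sub]
      hole_free_cong[of "A - {v}" "V - {v} - (A - {v})" "\<lambda>a b. (a, b) \<in> R" "\<lambda>a b. (a, b) \<in> R'"] eq
    by simp
  moreover have "c4_p3_free (A - {v}) (V - {v} - (A - {v})) (\<lambda>a b. (a, b) \<in> R')"
    using c4_p3_free_mono[OF *(4) sub] eq unfolding c4_p3_free_def by simp
  ultimately show ?thesis using * by (auto simp: p coded_graphs_def delete_vertex_def R'_def)
qed

text \<open>All arcs at \<open>v\<close> point the same way, because \<open>R\<close> runs from
  \<open>A\<close> to its complement; so the side and the neighbourhood of \<open>v\<close> restore
  them.\<close>

lemma insert_delete_vertex:
  assumes "p \<in> coded_graphs V"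
  shows "insert_vertex v (v \<in> fst p) (nbrs (snd p) v) (delete_vertex v p) = p"
proof -
  obtain A R where p: "p = (A, R)" by (cases p)
  have R: "R \<subseteq> A \<times> - A" using assms by (auto simp: p coded_graphs_def)
  show ?thesis
  proof (cases "v \<in> A")
    case True
    then have "R \<inter> (- {v}) \<times> (- {v}) \<union> {v} \<times> nbrs R v = R" using R by (auto simp: nbrs_def)
    then show ?thesis using True by (simp add: p insert_vertex_def delete_vertex_def insert_absorb)
  next
    case False
    then have "R \<inter> (- {v}) \<times> (- {v}) \<union> nbrs R v \<times> {v} = R" using R by (auto simp: nbrs_def)
    then show ?thesis using False by (simp add: p insert_vertex_def delete_vertex_def)
  qed
qed

text \<open>If \<open>A\<close> is empty, any vertex has the empty neighbourhood. Otherwise there is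
  a vertex of \<open>A\<close> of degree at most 3, a vertex complete to \<open>A\<close>, or a pair
  of twins, and each matches one kind of candidate.\<close>

lemma candidate_vertex:
  assumes "finite V" "V \<noteq> {}" "p \<in> coded_graphs V"
  shows "\<exists>v\<in>V. nbrs (snd p) v \<in> candidates (V - {v}) (delete_vertex v p)"
proof -
  obtain A R where p: "p = (A, R)" by (cases p)
  define E where "E = (\<lambda>a b. (a, b) \<in> R)"
  have AR: "A \<subseteq> V" "R \<subseteq> A \<times> (V - A)" and E: "hole_free A (V - A) E" "c4_p3_free A (V - A) E"
    using assms(3) by (auto simp: p coded_graphs_def E_def)
  have fin: "finite A" "finite (V - A)" using AR assms finite_subset by auto
  have nbA: "nbrs R w = {b \<in> V - A. E w b}" if "w \<in> A" for w
    using that AR by (auto simp: nbrs_def E_def)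
  have nbB: "nbrs R b = nbhd A E b" if "b \<in> V - A" for b
    using that AR by (auto simp: nbrs_def nbhd_def E_def)
  have "\<exists>b\<in>V - A. \<exists>b'\<in>V - A. b \<noteq> b' \<and> nbhd A E b = nbhd A E b'"
    if "A \<noteq> {}" "\<And>w. w \<in> A \<Longrightarrow> \<not> card {b \<in> V - A. E w b} \<le> 3" "\<And>b. b \<in> V - A \<Longrightarrow> \<not> A \<subseteq> nbhd A E b"
    using low_degree_or_dominating_or_twins[OF fin that(1) E _ that(3)] that(2)
    by (metis not_le)
  then consider "A = {}" | w where "w \<in> A" "card {b \<in> V - A. E w b} \<le> 3"
    | b where "b \<in> V - A" "A \<subseteq> nbhd A E b"
    | b b' where "b \<in> V - A" "b' \<in> V - A" "b \<noteq> b'" "nbhd A E b = nbhd A E b'"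
    by blast
  then show ?thesis
  proof cases
    case 1
    moreover obtain v where "v \<in> V" using assms by auto
    ultimately show ?thesis using AR by (intro bexI[of _ v]) (auto simp: p candidates_def nbrs_def)
  next
    case (2 w)
    then have "nbrs R w \<subseteq> V - {w}" "card (nbrs R w) \<le> 3" using nbA[of w] by auto
    then show ?thesis using 2 AR by (intro bexI[of _ w]) (auto simp: p candidates_def)
  next
    case (3 b)
    then have "nbrs R b = A - {b}" using nbB[of b] by (auto simp: nbhd_def)
    then show ?thesis using 3 by (intro bexI[of _ b]) (auto simp: p candidates_def delete_vertex_def)
  next
    case (4 b b')
    \<comment> \<open>\<open>b\<close> and \<open>b'\<close> are in the same colour class, so
      deleting \<open>b\<close> removes no arc at \<open>b'\<close>.\<close>
    have "nbrs R b' = nbrs (R \<inter> (- {b}) \<times> (- {b})) b'"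
      using 4 AR by (auto simp: nbrs_def)
    then have "nbrs R b = nbrs (R \<inter> (- {b}) \<times> (- {b})) b'"
      using 4 nbB by simp
    then show ?thesis using 4 by (intro bexI[of _ b]) (auto simp: p candidates_def delete_vertex_def)
  qed
qed

section \<open>Number of codes\<close>

text \<open>Nonempty sets of at most three elements come from triples, with entries repeated for the
  smaller ones; the summand 1 is for the empty set.\<close>

lemma card_small_subsets_le:
  assumes "finite V"
  shows "card {X. X \<subseteq> V \<and> card X \<le> 3} \<le> card V ^ 3 + 1"
proof -
  have "X \<in> insert {} ((\<lambda>(a, b, c). {a, b, c}) ` (V \<times> V \<times> V))" if X: "X \<subseteq> V" "card X \<le> 3" for X
  proof (cases "X = {}")
    case False
    then have "card X \<noteq> 0" using X assms by (metis card_0_eq finite_subset)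
    then consider "card X = 1" | "card X = 2" | "card X = 3" using X(2) by linarith
    then obtain a b c where "X = {a, b, c}"
    proof cases
      case 1
      then obtain a where "X = {a}" by (rule card_1_singletonE)
      then show ?thesis using that[of a a a] by simp
    next
      case 2
      then obtain a b where "X = {a, b}" by (auto simp: card_2_iff)
      then show ?thesis using that[of a b b] by simp
    next
      case 3
      then obtain a b c where "X = {a, b, c}" by (auto simp: card_3_iff)
      then show ?thesis by (rule that)
    qed
    then show ?thesis using X by (force intro!: image_eqI[of _ _ "(a, b, c)"])
  qed simp
  then have "{X. X \<subseteq> V \<and> card X \<le> 3} \<subseteq> insert {} ((\<lambda>(a, b, c). {a, b, c}) ` (V \<times> V \<times> V))"
    by blast
  then have "card {X. X \<subseteq> V \<and> card X \<le> 3} \<le> card (insert {} ((\<lambda>(a, b, c). {a, b, c}) ` (V \<times> V \<times> V)))"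
    using assms by (intro card_mono) auto
  also have "\<dots> \<le> Suc (card ((\<lambda>(a, b, c). {a, b, c}) ` (V \<times> V \<times> V)))"
    by (rule card_insert_le_m1) auto
  also have "\<dots> \<le> Suc (card (V \<times> V \<times> V))"
    using assms by (intro Suc_le_mono[THEN iffD2] card_image_le) auto
  finally show ?thesis by (simp add: card_cartesian_product power3_eq_cube mult.assoc)
qed

lemma card_candidates_le:
  assumes "finite V"
  shows "card (candidates V p) \<le> 2 * Suc (card V) ^ 3"
proof -
  have "card (candidates V p) \<le> (card V ^ 3 + 1) + 1 + card V"
    unfolding candidates_def
    by (intro order_trans[OF card_Un_le] add_mono card_small_subsets_le card_image_le assms) simp
  also have "\<dots> \<le> 2 * Suc (card V) ^ 3"
    by (simp add: power3_eq_cube algebra_simps)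
  finally show ?thesis .
qed

text \<open>Each deletion costs |V| choices of the vertex, at most 2|V|^3 candidates and 2 sides, so
  a factor of at most 4n^4. The bound \<open>n\<close> stays fixed while \<open>V\<close> shrinks,
  so the factors multiply to a power.\<close>

lemma card_coded_graphs_le:
  assumes "finite V" "card V \<le> n"
  shows "card (coded_graphs V) \<le> (4 * n ^ 4) ^ card V"
  using assms
proof (induction V rule: finite_psubset_induct)
  case (psubset V)
  show ?case
  proof (cases "V = {}")
    case True
    have "coded_graphs V \<subseteq> {({}, {})}" by (auto simp: True coded_graphs_def)
    then show ?thesis using card_mono[of "{({}, {})}" "coded_graphs V"] True by simp
  next
    case False
    define m where "m = card V - 1"
    have m: "card V = Suc m" "Suc m \<le> n" using False psubset by (auto simp: m_def card_gt_0_iff)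
    define D where "D = (SIGMA v:V. SIGMA p:coded_graphs (V - {v}). candidates (V - {v}) p \<times> (UNIV :: bool set))"
    have "p \<in> (\<lambda>(v, q, X, s). insert_vertex v s X q) ` D" if p: "p \<in> coded_graphs V" for p
    proof -
      obtain v where "v \<in> V" "nbrs (snd p) v \<in> candidates (V - {v}) (delete_vertex v p)"
        using candidate_vertex[OF psubset.hyps False p] by blast
      then show ?thesis
        using insert_delete_vertex[OF p, of v] delete_vertex_in_coded_graphs[OF p, of v]
        by (intro image_eqI[of _ _ "(v, delete_vertex v p, nbrs (snd p) v, v \<in> fst p)"])
          (auto simp: D_def)
    qed
    then have "coded_graphs V \<subseteq> (\<lambda>(v, q, X, s). insert_vertex v s X q) ` D" by blast
    moreover have finC: "finite (candidates (V - {v}) p)" for v p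
      using psubset.hyps by (auto simp: candidates_def)
    moreover have "finite D" unfolding D_def
      using psubset.hyps finC by (intro finite_SigmaI finite_coded_graphs) auto
    ultimately have "card (coded_graphs V) \<le> card D"
      by (meson card_image_le card_mono finite_imageI order_trans)
    also have "card D = (\<Sum>v\<in>V. \<Sum>p\<in>coded_graphs (V - {v}). card (candidates (V - {v}) p) * 2)"
      unfolding D_def using psubset.hyps finC
      by (simp add: card_SigmaI finite_coded_graphs card_cartesian_product)
    also have "\<dots> \<le> (\<Sum>v\<in>V. \<Sum>p\<in>coded_graphs (V - {v}). 4 * Suc m ^ 3)"
    proof (intro sum_mono)
      fix v p assume "v \<in> V"
      then have "card (candidates (V - {v}) p) \<le> 2 * Suc m ^ 3"
        using card_candidates_le[of "V - {v}" p] psubset.hyps m by simp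
      then show "card (candidates (V - {v}) p) * 2 \<le> 4 * Suc m ^ 3" by simp
    qed
    also have "\<dots> \<le> (\<Sum>v\<in>V. (4 * n ^ 4) ^ m * (4 * Suc m ^ 3))"
    proof (rule sum_mono)
      fix v assume v: "v \<in> V"
      have "card (coded_graphs (V - {v})) \<le> (4 * n ^ 4) ^ card (V - {v})"
        using v psubset.prems m psubset.hyps by (intro psubset.IH) auto
      then show "(\<Sum>p\<in>coded_graphs (V - {v}). 4 * Suc m ^ 3) \<le> (4 * n ^ 4) ^ m * (4 * Suc m ^ 3)"
        using v m psubset.hyps by simp
    qed
    also have "\<dots> = (4 * n ^ 4) ^ m * (4 * (Suc m * Suc m ^ 3))"
      by (simp only: sum_constant m(1) of_nat_id ac_simps)
    also have "\<dots> = (4 * n ^ 4) ^ m * (4 * Suc m ^ 4)"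
      by (simp add: eval_nat_numeral)
    also have "\<dots> \<le> (4 * n ^ 4) ^ m * (4 * n ^ 4)"
      using m by (intro mult_left_mono power_mono) auto
    finally show ?thesis by (simp only: m(1) power_Suc2)
  qed
qed

subsection \<open>Induced embeddings\<close>

text \<open>A map of vertices replaces the induced subgraph together with its isomorphism, so that
  copies can be transported by composition.\<close>

definition induced_embedding :: "('b \<Rightarrow> 'a) \<Rightarrow> 'b pair_pre_digraph \<Rightarrow> 'a pair_pre_digraph \<Rightarrow> bool" where
  "induced_embedding f H G \<longleftrightarrow> inj_on f (pverts H) \<and> f ` pverts H \<subseteq> pverts G \<and>
     (\<forall>u\<in>pverts H. \<forall>v\<in>pverts H. (f u, f v) \<in> parcs G \<longleftrightarrow> (u, v) \<in> parcs H)"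

lemma induced_embedding_comp:
  assumes "induced_embedding f H G" "induced_embedding g G K"
  shows "induced_embedding (g \<circ> f) H K"
proof -
  have "inj_on (g \<circ> f) (pverts H)"
    using assms by (intro comp_inj_on) (auto simp: induced_embedding_def intro: inj_on_subset)
  then show ?thesis using assms by (simp add: induced_embedding_def image_subset_iff)
qed

lemma pair_wf_parcs:
  assumes "pair_wf_digraph G" "(u, v) \<in> parcs G"
  shows "u \<in> pverts G" "v \<in> pverts G"
  using pair_wf_digraph.arc_fst_in_verts[OF assms(1)] pair_wf_digraph.arc_snd_in_verts[OF assms(1)]
    assms(2) by auto

text \<open>The arcs of a pair graph are their own end pairs, so the separate arc map of an
  isomorphism must be \<open>map_prod f f\<close>.\<close>

lemma digraph_iso_with_proj_iff:
  "digraph_iso (with_proj G) (with_proj H) \<longleftrightarrow> pair_wf_digraph G \<and>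
     (\<exists>f. inj_on f (pverts G) \<and> pverts H = f ` pverts G \<and> parcs H = map_prod f f ` parcs G)"
proof
  assume "digraph_iso (with_proj G) (with_proj H)"
  then obtain h where h: "pre_digraph.digraph_isomorphism (with_proj G) h"
    and eq: "with_proj H = app_iso h (with_proj G)"
    by (auto simp: digraph_iso_def)
  have *: "pverts H = iso_verts h ` pverts G" "parcs H = iso_arcs h ` parcs G"
    "iso_tail h = fst" "iso_head h = snd"
    using arg_cong[OF eq, of verts] arg_cong[OF eq, of arcs] arg_cong[OF eq, of tail]
      arg_cong[OF eq, of head] by simp_all
  have "iso_arcs h a = map_prod (iso_verts h) (iso_verts h) a" if "a \<in> parcs G" for a
    using h that by (auto simp: pre_digraph.digraph_isomorphism_def * prod_eq_iff)
  then have "parcs H = map_prod (iso_verts h) (iso_verts h) ` parcs G" using * by simp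
  then show "pair_wf_digraph G \<and>
     (\<exists>f. inj_on f (pverts G) \<and> pverts H = f ` pverts G \<and> parcs H = map_prod f f ` parcs G)"
    using h * by (auto simp: pre_digraph.digraph_isomorphism_def wf_digraph_wp_iff)
next
  assume "pair_wf_digraph G \<and>
     (\<exists>f. inj_on f (pverts G) \<and> pverts H = f ` pverts G \<and> parcs H = map_prod f f ` parcs G)"
  then obtain f where wf: "pair_wf_digraph G"
    and f: "inj_on f (pverts G)" "pverts H = f ` pverts G" "parcs H = map_prod f f ` parcs G" by auto
  define h where "h = \<lparr>iso_verts = f, iso_arcs = map_prod f f, iso_head = snd, iso_tail = fst\<rparr>"
  have "inj_on (map_prod f f) (parcs G)"
    by (rule inj_on_subset[OF map_prod_inj_on[OF f(1) f(1)]]) (auto dest: pair_wf_parcs[OF wf])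
  then have "pre_digraph.digraph_isomorphism (with_proj G) h"
    using f wf by (simp add: pre_digraph.digraph_isomorphism_def h_def wf_digraph_wp_iff)
  moreover have "with_proj H = app_iso h (with_proj G)"
    using f by (simp add: h_def app_iso_def with_proj_def)
  ultimately show "digraph_iso (with_proj G) (with_proj H)" by (auto simp: digraph_iso_def)
qed

lemma induced_subgraph_with_proj_iff:
  "induced_subgraph (with_proj H) (with_proj G) \<longleftrightarrow> pair_wf_digraph H \<and> pair_wf_digraph G \<and>
     pverts H \<subseteq> pverts G \<and> parcs H = parcs G \<inter> pverts H \<times> pverts H"
  by (auto simp: induced_subgraph_def subgraph_def wf_digraph_wp_iff compatible_def)

text \<open>The inverse of the vertex map is the embedding; \<open>H\<close> is well-formed because
  its arcs are images of arcs of \<open>K\<close>.\<close>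

lemma digraph_iso_embedding:
  assumes "digraph_iso (with_proj K) (with_proj H)"
  obtains f where "pair_wf_digraph H" "induced_embedding f H K"
proof -
  from assms obtain g where g: "pair_wf_digraph K" "inj_on g (pverts K)"
    "pverts H = g ` pverts K" "parcs H = map_prod g g ` parcs K"
    by (auto simp: digraph_iso_with_proj_iff)
  define f where "f = the_inv_into (pverts K) g"
  have fg: "f (g u) = u" if "u \<in> pverts K" for u
    using that g(2) by (simp add: f_def the_inv_into_f_f)
  have "pair_wf_digraph H"
    by unfold_locales (use pair_wf_parcs[OF g(1)] in \<open>auto simp: g(3,4)\<close>)
  moreover have "induced_embedding f H K"
    unfolding induced_embedding_def
  proof (intro conjI ballI)
    show "inj_on f (pverts H)" "f ` pverts H \<subseteq> pverts K" using fg by (auto simp: g(3) inj_on_def)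
    fix u v assume "u \<in> pverts H" "v \<in> pverts H"
    then obtain u' v' where uv: "u = g u'" "v = g v'" "u' \<in> pverts K" "v' \<in> pverts K"
      by (auto simp: g(3))
    show "(f u, f v) \<in> parcs K \<longleftrightarrow> (u, v) \<in> parcs H"
    proof
      assume "(u, v) \<in> parcs H"
      then obtain a b where ab: "(a, b) \<in> parcs K" "u = g a" "v = g b" by (auto simp: g(4))
      then have "a = u'" "b = v'" using inj_onD[OF g(2)] uv pair_wf_parcs[OF g(1)] by metis+
      then show "(f u, f v) \<in> parcs K" using ab uv fg by simp
    qed (use uv fg in \<open>auto simp: g(4)\<close>)
  qed
  ultimately show ?thesis by (rule that)
qed

text \<open>The image of an embedding is an induced copy; conversely, an inverse isomorphism
  followed by the inclusion of the copy is an embedding.\<close>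

lemma induced_free_iff:
  assumes "pair_wf_digraph G" "pair_wf_digraph H"
  shows "induced_free H G \<longleftrightarrow> \<not> (\<exists>f. induced_embedding f H G)"
proof
  assume free: "induced_free H G"
  show "\<not> (\<exists>f. induced_embedding f H G)"
  proof
    assume "\<exists>f. induced_embedding f H G"
    then obtain f where f: "inj_on f (pverts H)" "f ` pverts H \<subseteq> pverts G"
      "\<And>u v. u \<in> pverts H \<Longrightarrow> v \<in> pverts H \<Longrightarrow> (f u, f v) \<in> parcs G \<longleftrightarrow> (u, v) \<in> parcs H"
      by (auto simp: induced_embedding_def)
    define g where "g = the_inv_into (pverts H) f"
    have gf: "g (f u) = u" if "u \<in> pverts H" for u
      using that f(1) by (simp add: g_def the_inv_into_f_f)
    define K where "K = \<lparr>pverts = f ` pverts H, parcs = map_prod f f ` parcs H\<rparr>"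
    note H = pair_wf_parcs[OF assms(2)]
    have wfK: "pair_wf_digraph K" by unfold_locales (auto simp: K_def dest: H)
    have K: "pverts K = f ` pverts H" "parcs K = map_prod f f ` parcs H" by (simp_all add: K_def)
    have "induced_subgraph (with_proj K) (with_proj G)"
      unfolding induced_subgraph_with_proj_iff
    proof (intro conjI wfK assms(1))
      show "pverts K \<subseteq> pverts G" using f(2) by (simp add: K)
      show "parcs K = parcs G \<inter> pverts K \<times> pverts K"
      proof (intro equalityI subrelI)
        fix x y assume "(x, y) \<in> parcs K"
        then obtain u v where "(u, v) \<in> parcs H" "x = f u" "y = f v" by (auto simp: K)
        then show "(x, y) \<in> parcs G \<inter> pverts K \<times> pverts K" using f(3) H by (simp add: K)
      next
        fix x y assume xy: "(x, y) \<in> parcs G \<inter> pverts K \<times> pverts K"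
        then obtain u v where "u \<in> pverts H" "v \<in> pverts H" "x = f u" "y = f v" by (auto simp: K)
        then show "(x, y) \<in> parcs K" using f(3) xy by (force simp: K)
      qed
    qed
    moreover have "digraph_iso (with_proj K) (with_proj H)"
      unfolding digraph_iso_with_proj_iff
    proof (intro conjI wfK exI[of _ g])
      show "inj_on g (pverts K)" using gf by (auto simp: K inj_on_def)
      show "pverts H = g ` pverts K" using gf by (force simp: K)
      have "map_prod g g ` map_prod f f ` parcs H = id ` parcs H"
        unfolding image_image by (rule image_cong) (auto intro!: gf intro: H)
      then show "parcs H = map_prod g g ` parcs K" by (simp add: K)
    qed
    ultimately show False using free by (auto simp: induced_free_def)
  qed
next
  assume none: "\<not> (\<exists>f. induced_embedding f H G)"
  show "induced_free H G"
    unfolding induced_free_def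
  proof
    assume "\<exists>K. induced_subgraph (with_proj K) (with_proj G) \<and> digraph_iso (with_proj K) (with_proj H)"
    then obtain K where K: "induced_subgraph (with_proj K) (with_proj G)"
      "digraph_iso (with_proj K) (with_proj H)" by blast
    obtain f where "induced_embedding f H K" using digraph_iso_embedding[OF K(2)] .
    moreover have "induced_embedding id K G"
      using K(1) by (auto simp: induced_subgraph_with_proj_iff induced_embedding_def)
    ultimately show False using none induced_embedding_comp by blast
  qed
qed

lemma pair_graph_embedding:
  assumes "pair_graph G" "pair_wf_digraph H" "induced_embedding f H G"
  shows "pair_graph H"
proof -
  interpret G: pair_graph G by fact
  interpret H: pair_wf_digraph H by fact
  have f: "inj_on f (pverts H)" "f ` pverts H \<subseteq> pverts G"
    "\<And>u v. u \<in> pverts H \<Longrightarrow> v \<in> pverts H \<Longrightarrow> (f u, f v) \<in> parcs G \<longleftrightarrow> (u, v) \<in> parcs H"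
    using assms(3) by (auto simp: induced_embedding_def)
  note H = pair_wf_parcs[OF assms(2)]
  have "finite (pverts H)"
    using f(1,2) G.pair_finite_verts by (meson finite_imageD finite_subset)
  moreover then have "finite (parcs H)"
    by (intro finite_subset[of "parcs H" "pverts H \<times> pverts H"]) (auto dest: H)
  moreover have "sym (parcs H)"
  proof (rule symI)
    fix u v assume uv: "(u, v) \<in> parcs H"
    then have "(f u, f v) \<in> parcs G" using f(3) H by simp
    then have "(f v, f u) \<in> parcs G"
      using G.pair_sym_arcs by (simp add: symmetric_def symD)
    then show "(v, u) \<in> parcs H" using f(3) H uv by simp
  qed
  moreover have "u \<noteq> v" if "(u, v) \<in> parcs H" for u v
  proof
    assume "u = v"
    then have "(f u, f u) \<in> parcs G" using f(3)[of u u] H[OF that] that by simp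
    then show False using G.pair_no_loops[of "(f u, f u)"] by simp
  qed
  ultimately show ?thesis
    by unfold_locales (auto simp: symmetric_def)
qed

text \<open>The preimages of the colour classes under \<open>f\<close> are colour classes of
  \<open>H\<close>.\<close>

lemma bipartite_graph_embedding:
  assumes "bipartite_graph G" "pair_wf_digraph H" "induced_embedding f H G"
  shows "bipartite_graph H"
proof -
  from assms(1) obtain A B where G: "pair_graph G" "pverts G = A \<union> B" "A \<inter> B = {}"
    "parcs G \<subseteq> A \<times> B \<union> B \<times> A" by (auto simp: bipartite_graph_def)
  have "pair_graph H" using pair_graph_embedding G assms by blast
  moreover have "\<exists>A B. pverts H = A \<union> B \<and> A \<inter> B = {} \<and> parcs H \<subseteq> A \<times> B \<union> B \<times> A"
  proof (intro exI conjI)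
    show "pverts H = (pverts H \<inter> f -` A) \<union> (pverts H \<inter> f -` B)"
      using assms(3) G(2) by (auto simp: induced_embedding_def)
    show "(pverts H \<inter> f -` A) \<inter> (pverts H \<inter> f -` B) = {}" using G(3) by auto
    show "parcs H \<subseteq> (pverts H \<inter> f -` A) \<times> (pverts H \<inter> f -` B) \<union> (pverts H \<inter> f -` B) \<times> (pverts H \<inter> f -` A)"
    proof (rule subrelI)
      fix u v assume uv: "(u, v) \<in> parcs H"
      then have "u \<in> pverts H" "v \<in> pverts H" using pair_wf_parcs[OF assms(2)] by blast+
      moreover from this uv have "(f u, f v) \<in> A \<times> B \<union> B \<times> A"
        using assms(3) G(4) unfolding induced_embedding_def by blast
      ultimately show "(u, v) \<in> (pverts H \<inter> f -` A) \<times> (pverts H \<inter> f -` B) \<union>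
          (pverts H \<inter> f -` B) \<times> (pverts H \<inter> f -` A)" by auto
    qed
  qed
  ultimately show ?thesis by (simp add: bipartite_graph_def)
qed

lemma pair_wf_if_pair_graph: "pair_graph G \<Longrightarrow> pair_wf_digraph G"
  by (simp add: pair_graph_def pair_digraph_def pair_fin_digraph_def)

lemma induced_free_embedding:
  assumes "induced_free X G" "pair_wf_digraph X" "pair_wf_digraph G" "pair_wf_digraph H"
    "induced_embedding f H G"
  shows "induced_free X H"
proof -
  have "\<not> (\<exists>g. induced_embedding g X G)" using assms(1) induced_free_iff[OF assms(3,2)] by simp
  then have "\<not> (\<exists>g. induced_embedding g X H)" using induced_embedding_comp[OF _ assms(5)] by blast
  then show ?thesis using induced_free_iff[OF assms(4,2)] by simp
qed

lemma pair_wf_cycle_graph: "k \<ge> 3 \<Longrightarrow> pair_wf_digraph (cycle_graph k)"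
  by (rule pair_wf_if_pair_graph) (rule pair_graph_cycle_graph)

lemma pair_wf_Y_graph: "pair_wf_digraph Y_graph"
  by (rule pair_wf_if_pair_graph) (rule pair_graph_Y_graph)

section \<open>Closure properties of the class\<close>

text \<open>Isomorphic images and induced subgraphs both embed into the given graph, so closure
  under induced embeddings covers both.\<close>

lemma hereditary_Y_free_chordal_bipartite:
  "hereditary_class {G. chordal_bipartite G \<and> induced_free Y_graph G}" (is "hereditary_class ?C")
proof -
  have pg: "pair_graph G" if "G \<in> ?C" for G
    using that by (simp add: chordal_bipartite_def bipartite_graph_def)
  have closed: "H \<in> ?C" if "G \<in> ?C" "pair_wf_digraph H" "induced_embedding f H G" for G H f
  proof -
    have wf: "pair_wf_digraph G" using pg[OF that(1)] by (rule pair_wf_if_pair_graph)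
    have "bipartite_graph H"
      using that bipartite_graph_embedding unfolding chordal_bipartite_def by blast
    moreover have "induced_free (cycle_graph k) H" if "k \<ge> 6" for k
      using induced_free_embedding[OF _ pair_wf_cycle_graph wf \<open>pair_wf_digraph H\<close>
          \<open>induced_embedding f H G\<close>] that \<open>G \<in> ?C\<close>
      by (simp add: chordal_bipartite_def)
    moreover have "induced_free Y_graph H"
      using induced_free_embedding[OF _ pair_wf_Y_graph wf] that by blast
    ultimately show ?thesis by (simp add: chordal_bipartite_def)
  qed
  show ?thesis
    unfolding hereditary_class_def
  proof (intro conjI ballI allI impI)
    fix G assume G: "G \<in> ?C"
    show "pair_graph G" using pg G .
    fix H
    show "H \<in> ?C" if iso: "digraph_iso (with_proj G) (with_proj H)"
      using digraph_iso_embedding[OF iso] closed[OF G] by blast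
    show "H \<in> ?C" if "induced_subgraph (with_proj H) (with_proj G)"
    proof (rule closed[OF G, of _ id])
      show "pair_wf_digraph H" "induced_embedding id H G"
        using that by (auto simp: induced_subgraph_with_proj_iff induced_embedding_def)
    qed
  qed
qed

section \<open>From graphs to codes\<close>

text \<open>Equal vertices with different indices would make \<open>i\<close> and \<open>j\<close>
  successors of each other modulo \<open>n\<close>, so \<open>n\<close> would divide 2.\<close>

lemma hole_inj:
  assumes "hole A B E n a b" "n \<ge> 3" "i < n" "j < n"
  shows "a i = a j \<Longrightarrow> i = j" "b i = b j \<Longrightarrow> i = j"
proof -
  have mod: "Suc k mod n = (if Suc k = n then 0 else Suc k)" if "k < n" for k using that by auto
  have E: "E (a i) (b j) \<longleftrightarrow> j = i \<or> j = (if Suc i = n then 0 else Suc i)" if "i < n" "j < n" for i j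
    using assms(1) that mod by (auto simp: hole_def)
  {
    assume "a i = a j"
    then have "E (a j) (b i)" "E (a i) (b j)" using E[of i i] E[of j j] assms by auto
    then show "i = j" using E[of j i] E[of i j] assms by (auto split: if_splits)
  next
    assume "b i = b j"
    then have "E (a j) (b i)" "E (a i) (b j)" using E[of i i] E[of j j] assms by auto
    then show "i = j" using E[of j i] E[of i j] assms by (auto split: if_splits)
  }
qed

text \<open>The odd vertex 2i + 1 of the cycle goes to \<open>a i\<close>; its neighbours 2i and 2i
  + 2 go to \<open>b i\<close> and the next \<open>b\<close>.\<close>

lemma hole_embedding:
  assumes G: "bipartite_graph G" "pverts G = A \<union> B" "A \<inter> B = {}" "parcs G \<subseteq> A \<times> B \<union> B \<times> A"
    and h: "hole A B (\<lambda>a b. (a, b) \<in> parcs G) n a b" and n: "n \<ge> 3"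
  shows "induced_embedding (\<lambda>i. if even i then b (i div 2) else a (i div 2)) (cycle_graph (2 * n)) G"
    (is "induced_embedding ?f _ _")
proof -
  have sym: "(u, v) \<in> parcs G \<longleftrightarrow> (v, u) \<in> parcs G" for u v
  proof -
    interpret pair_graph G using G(1) by (simp add: bipartite_graph_def)
    show ?thesis using pair_sym_arcs by (auto simp: symmetric_def dest: symD)
  qed
  have ab: "a i \<in> A" "b i \<in> B" "a i \<notin> B" "b i \<notin> A" if "i < n" for i
    using h G(3) that by (auto simp: hole_def)
  have E: "(a i, b j) \<in> parcs G \<longleftrightarrow> j = i \<or> j = Suc i mod n" if "i < n" "j < n" for i j
    using h that by (auto simp: hole_def)
  \<comment> \<open>Doubling respects the wrap-around: 2n - 1 is followed by 0 exactly as n - 1 is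
    modulo n.\<close>
  have odd_even: "(2 * i + 1, 2 * j) \<in> parcs (cycle_graph (2 * n)) \<longleftrightarrow> j = i \<or> j = Suc i mod n"
    if "i < n" "j < n" for i j
  proof -
    have "Suc (2 * i + 1) mod (2 * n) = 2 * (Suc i mod n)"
      using mult_mod_right[of 2 "Suc i" n] by simp
    moreover have "Suc (2 * j) mod (2 * n) = Suc (2 * j)" using that by simp
    ultimately show ?thesis using that by (auto simp: cycle_graph_def)
  qed
  have cyc_sym: "(u, v) \<in> parcs (cycle_graph k) \<longleftrightarrow> (v, u) \<in> parcs (cycle_graph k)" for u v k
    by (auto simp: cycle_graph_def)
  have same: "(u, v) \<notin> parcs (cycle_graph (2 * n))" if "even u \<longleftrightarrow> even v" for u v
  proof -
    have "even (k mod (2 * n)) \<longleftrightarrow> even k" for k by (simp add: dvd_mod_iff)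
    then have "u \<noteq> Suc v mod (2 * n)" "v \<noteq> Suc u mod (2 * n)" using that by (metis even_Suc)+
    then show ?thesis by (simp add: cycle_graph_def)
  qed
  show ?thesis
    unfolding induced_embedding_def
  proof (intro conjI ballI)
    have V: "pverts (cycle_graph (2 * n)) = {0..<2 * n}" by (simp add: cycle_graph_def)
    have half: "i div 2 < n" if "i \<in> pverts (cycle_graph (2 * n))" for i using that by (auto simp: V)
    show "inj_on ?f (pverts (cycle_graph (2 * n)))"
    proof (rule inj_onI)
      fix u v assume uv: "u \<in> pverts (cycle_graph (2 * n))" "v \<in> pverts (cycle_graph (2 * n))" "?f u = ?f v"
      then have "even u \<longleftrightarrow> even v" using ab half by (metis (full_types))
      moreover from this have "u div 2 = v div 2"
        using uv hole_inj[OF h n half[OF uv(1)] half[OF uv(2)]] by (auto split: if_splits)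
      ultimately show "u = v" by (metis even_iff_mod_2_eq_zero odd_iff_mod_2_eq_one div_mult_mod_eq)
    qed
    show "?f ` pverts (cycle_graph (2 * n)) \<subseteq> pverts G" using ab half by (auto simp: G(2))
    fix u v assume uv: "u \<in> pverts (cycle_graph (2 * n))" "v \<in> pverts (cycle_graph (2 * n))"
    consider "even u \<longleftrightarrow> even v" | i j where "u = 2 * i + 1" "v = 2 * j" | i j where "u = 2 * j" "v = 2 * i + 1"
      by (meson evenE oddE)
    then show "(?f u, ?f v) \<in> parcs G \<longleftrightarrow> (u, v) \<in> parcs (cycle_graph (2 * n))"
    proof cases
      case 1
      then have "(?f u, ?f v) \<notin> parcs G" using ab[OF half[OF uv(1)]] ab[OF half[OF uv(2)]] G(4) by auto
      then show ?thesis using same[OF 1] by simp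
    next
      case (2 i j)
      then have "i < n" "j < n" using uv by (auto simp: V)
      then show ?thesis using E odd_even unfolding 2 by simp
    next
      case (3 i j)
      then have "i < n" "j < n" using uv by (auto simp: V)
      then show ?thesis using E odd_even cyc_sym[of "2 * j"] sym[of "b j"] unfolding 3 by simp
    qed
  qed
qed

lemma pverts_Y_graph: "pverts Y_graph = {Inl 0, Inl 1, Inl 2, Inl 3, Inr 0, Inr 1, Inr 2}"
proof -
  have "{0..<4} = {0, 1, 2, 3 :: nat}" "{0..<3} = {0, 1, 2 :: nat}" by auto
  then show ?thesis
    by (auto simp: Y_graph_def disjoint_union_graph_def cycle_graph_def path_graph_def Plus_def)
qed

lemma parcs_Y_graph:
  "(Inl i, Inl j) \<in> parcs Y_graph \<longleftrightarrow> i < 4 \<and> j < 4 \<and> (j = Suc i mod 4 \<or> i = Suc j mod 4)"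
  "(Inr i, Inr j) \<in> parcs Y_graph \<longleftrightarrow> i < 3 \<and> j < 3 \<and> (j = Suc i \<or> i = Suc j)"
  "(Inl i, Inr j) \<notin> parcs Y_graph" "(Inr i, Inl j) \<notin> parcs Y_graph"
  by (auto simp: Y_graph_def disjoint_union_graph_def cycle_graph_def path_graph_def)

text \<open>A violation gives an embedding of \<open>Y\<close>: the cycle goes to \<open>x\<close>,
  \<open>c\<close>, \<open>z\<close>, \<open>d\<close> in this order and the path to
  \<open>t\<close>, \<open>w\<close>, \<open>t'\<close>.\<close>

lemma c4_p3_free_if_Y_free:
  assumes G: "bipartite_graph G" "pverts G = A \<union> B" "A \<inter> B = {}" "parcs G \<subseteq> A \<times> B \<union> B \<times> A"
    and free: "induced_free Y_graph G"
  shows "c4_p3_free A B (\<lambda>a b. (a, b) \<in> parcs G)"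
proof -
  have pg: "pair_graph G" using G(1) by (simp add: bipartite_graph_def)
  interpret pair_graph G by (rule pg)
  have sym: "(u, v) \<in> parcs G \<longleftrightarrow> (v, u) \<in> parcs G" for u v
    using pair_sym_arcs by (auto simp: symmetric_def dest: symD)
  have none: "(u, v) \<notin> parcs G" if "u \<in> A \<and> v \<in> A \<or> u \<in> B \<and> v \<in> B" for u v
    using that G(3,4) by auto
  show ?thesis
    unfolding c4_p3_free_def
  proof (intro ballI impI, rule ccontr)
    fix x z w c d t t'
    assume A: "x \<in> A" "z \<in> A" "w \<in> A" and B: "c \<in> B" "d \<in> B" "t \<in> B" "t' \<in> B"
      and ne: "x \<noteq> z" "c \<noteq> d" "t \<noteq> t'"
      and e: "(x, c) \<in> parcs G" "(x, d) \<in> parcs G" "(z, c) \<in> parcs G" "(z, d) \<in> parcs G"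
        "(w, t) \<in> parcs G" "(w, t') \<in> parcs G"
      and n: "\<not> ((w, c) \<in> parcs G \<or> (w, d) \<in> parcs G \<or> (x, t) \<in> parcs G \<or> (x, t') \<in> parcs G \<or>
          (z, t) \<in> parcs G \<or> (z, t') \<in> parcs G)"
    define f where "f = case_sum ((!) [x, c, z, d]) ((!) [t, w, t'])"
    have f: "f (Inl 0) = x" "f (Inl 1) = c" "f (Inl 2) = z" "f (Inl 3) = d"
      "f (Inr 0) = t" "f (Inr 1) = w" "f (Inr 2) = t'"
      by (simp_all add: f_def eval_nat_numeral)
    \<comment> \<open>Vertices of the cycle and of the path differ because their adjacencies
      do.\<close>
    have ne': "x \<noteq> w" "z \<noteq> w" "c \<noteq> t" "c \<noteq> t'" "d \<noteq> t" "d \<noteq> t'" using e n by auto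
    have AB: "a \<noteq> b" if "a \<in> A" "b \<in> B" for a b using that G(3) by auto
    note AB' = AB[OF A(1) B(1)] AB[OF A(1) B(2)] AB[OF A(1) B(3)] AB[OF A(1) B(4)]
      AB[OF A(2) B(1)] AB[OF A(2) B(2)] AB[OF A(2) B(3)] AB[OF A(2) B(4)]
      AB[OF A(3) B(1)] AB[OF A(3) B(2)] AB[OF A(3) B(3)] AB[OF A(3) B(4)]
    have e': "(c, x) \<in> parcs G" "(d, x) \<in> parcs G" "(c, z) \<in> parcs G" "(d, z) \<in> parcs G"
        "(t, w) \<in> parcs G" "(t', w) \<in> parcs G" using e sym by blast+
    have n': "(c, w) \<notin> parcs G" "(d, w) \<notin> parcs G" "(t, x) \<notin> parcs G" "(t', x) \<notin> parcs G"
        "(t, z) \<notin> parcs G" "(t', z) \<notin> parcs G" using n sym by blast+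
    have "induced_embedding f Y_graph G"
      unfolding induced_embedding_def
    proof (intro conjI)
      show "inj_on f (pverts Y_graph)"
        unfolding pverts_Y_graph
        using ne ne' AB' AB'[symmetric] ne[symmetric] ne'[symmetric]
        by (simp add: inj_on_def f f(2,6)[unfolded One_nat_def])
      show "f ` pverts Y_graph \<subseteq> pverts G"
        unfolding pverts_Y_graph by (simp add: f f(2,6)[unfolded One_nat_def] A B G(2))
      show "\<forall>u\<in>pverts Y_graph. \<forall>v\<in>pverts Y_graph. (f u, f v) \<in> parcs G \<longleftrightarrow> (u, v) \<in> parcs Y_graph"
        unfolding pverts_Y_graph ball_simps
        by (simp only: f) (simp add: parcs_Y_graph e e' n n' none A B n[simplified])
    qed
    then show False
      using free induced_free_iff[OF pair_wf_if_pair_graph[OF pg] pair_wf_Y_graph] by blast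
  qed
qed

definition symmetric_graph :: "'a set \<Rightarrow> ('a \<times> 'a) set \<Rightarrow> 'a pair_pre_digraph" where
  "symmetric_graph V R = \<lparr>pverts = V, parcs = R \<union> R\<inverse>\<rparr>"

text \<open>Any bipartition of the graph yields a code. A graph may have several codes, which is
  harmless for an upper bound.\<close>

lemma labelled_graphs_subset_coded_graphs:
  "labelled_graphs {G. chordal_bipartite G \<and> induced_free Y_graph G} n
     \<subseteq> (\<lambda>(A, R). symmetric_graph {1..n} R) ` coded_graphs {1..n}"
proof
  fix G assume "G \<in> labelled_graphs {G. chordal_bipartite G \<and> induced_free Y_graph G} n"
  then have G: "chordal_bipartite G" "induced_free Y_graph G" "pverts G = {1..n}"
    by (auto simp: labelled_graphs_def)
  have bip: "bipartite_graph G" using G(1) by (simp add: chordal_bipartite_def)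
  then obtain A B where AB: "pair_graph G" "pverts G = A \<union> B" "A \<inter> B = {}"
    "parcs G \<subseteq> A \<times> B \<union> B \<times> A" by (auto simp: bipartite_graph_def)
  define R where "R = parcs G \<inter> A \<times> B"
  have B: "{1..n} - A = B" using AB G(3) by auto
  have RE: "(a, b) \<in> parcs G \<longleftrightarrow> (a, b) \<in> R" if "a \<in> A" "b \<in> B" for a b using that by (simp add: R_def)
  have "hole_free A B (\<lambda>a b. (a, b) \<in> parcs G)"
    unfolding hole_free_def
  proof (intro allI impI notI)
    \<comment> \<open>This \<open>n\<close> is half the length of the hole and hides the number of
      vertices.\<close>
    fix n :: nat and a b assume "3 \<le> n" "hole A B (\<lambda>a b. (a, b) \<in> parcs G) n a b"
    then have "\<exists>f. induced_embedding f (cycle_graph (2 * n)) G"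
      using hole_embedding[OF bip AB(2,3,4)] by blast
    moreover have "induced_free (cycle_graph (2 * n)) G"
      using G(1) \<open>3 \<le> n\<close> by (simp add: chordal_bipartite_def)
    ultimately show False
      using induced_free_iff[OF pair_wf_if_pair_graph[OF AB(1)] pair_wf_cycle_graph[of "2 * n"]] \<open>3 \<le> n\<close>
      by simp
  qed
  then have "hole_free A B (\<lambda>a b. (a, b) \<in> R)"
    using hole_free_cong[of A B "\<lambda>a b. (a, b) \<in> parcs G" "\<lambda>a b. (a, b) \<in> R"] RE by simp
  moreover have "c4_p3_free A B (\<lambda>a b. (a, b) \<in> R)"
    using c4_p3_free_if_Y_free[OF bip AB(2,3,4) G(2)] RE unfolding c4_p3_free_def by simp
  ultimately have "(A, R) \<in> coded_graphs {1..n}"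
    using AB(2) G(3) B by (auto simp: coded_graphs_def R_def)
  moreover have "parcs G = R \<union> R\<inverse>"
  proof -
    interpret pair_graph G by (rule AB(1))
    have "sym (parcs G)" using pair_sym_arcs by (simp add: symmetric_def)
    then show ?thesis using AB(4) by (auto simp: R_def dest: symD)
  qed
  then have "G = symmetric_graph {1..n} R"
    using G(3) by (simp add: symmetric_graph_def)
  ultimately show "G \<in> (\<lambda>(A, R). symmetric_graph {1..n} R) ` coded_graphs {1..n}" by force
qed

subsection \<open>Star forests\<close>

text \<open>The leaf \<open>i\<close> hangs on the centre \<open>g i\<close>; for \<open>g\<close>
  with values in \<open>{1..m}\<close> the vertices above \<open>2 * m\<close> are isolated.\<close>

definition star_forest :: "nat \<Rightarrow> nat \<Rightarrow> (nat \<Rightarrow> nat) \<Rightarrow> nat pair_pre_digraph" where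
  "star_forest m n g = symmetric_graph {1..n} ((\<lambda>i. (i, g i)) ` {m<..2 * m})"

lemma parcs_star_forest:
  "(u, v) \<in> parcs (star_forest m n g) \<longleftrightarrow> u \<in> {m<..2 * m} \<and> v = g u \<or> v \<in> {m<..2 * m} \<and> u = g v"
  by (auto simp: star_forest_def symmetric_graph_def)

text \<open>Every edge of a star forest has an end of degree one, whereas both ends of
  \<open>uv\<close> have a further neighbour. Cycles and the 4-cycle of \<open>Y\<close> contain
  such an edge.\<close>

lemma star_forest_no_embedding:
  assumes g: "g \<in> {m<..2 * m} \<rightarrow> {1..m}" and H: "pair_wf_digraph H"
    and e: "(u, v) \<in> parcs H" "(u, u') \<in> parcs H" "u' \<noteq> v" "(v, v') \<in> parcs H" "v' \<noteq> u"
  shows "\<not> induced_embedding f H (star_forest m n g)"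
proof
  assume f: "induced_embedding f H (star_forest m n g)"
  have V: "u \<in> pverts H" "v \<in> pverts H" "u' \<in> pverts H" "v' \<in> pverts H"
    using pair_wf_parcs[OF H] e by blast+
  then have arcs: "(f u, f v) \<in> parcs (star_forest m n g)" "(f u, f u') \<in> parcs (star_forest m n g)"
    "(f v, f v') \<in> parcs (star_forest m n g)" and ne: "f u' \<noteq> f v" "f v' \<noteq> f u"
    using f e by (auto simp: induced_embedding_def dest: inj_onD)
  have disj: "g i \<notin> {m<..2 * m}" if "i \<in> {m<..2 * m}" for i
    using funcset_mem[OF g that] by auto
  have leaf: "y = g x" if "(x, y) \<in> parcs (star_forest m n g)" "x \<in> {m<..2 * m}" for x y
    using that disj[of y] unfolding parcs_star_forest by blast
  have sym: "(y, x) \<in> parcs (star_forest m n g)" if "(x, y) \<in> parcs (star_forest m n g)" for x y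
    using that unfolding parcs_star_forest by blast
  have "f u \<in> {m<..2 * m} \<or> f v \<in> {m<..2 * m}"
    using arcs(1) unfolding parcs_star_forest by blast
  then show False
  proof
    assume *: "f u \<in> {m<..2 * m}"
    show False using leaf[OF arcs(1) *] leaf[OF arcs(2) *] ne(1) by simp
  next
    assume *: "f v \<in> {m<..2 * m}"
    show False using leaf[OF sym[OF arcs(1)] *] leaf[OF arcs(3) *] ne(2) by simp
  qed
qed

lemma star_forest_in_class:
  assumes g: "g \<in> {m<..2 * m} \<rightarrow> {1..m}" and "2 * m \<le> n"
  shows "star_forest m n g \<in> labelled_graphs {G. chordal_bipartite G \<and> induced_free Y_graph G} n"
proof -
  let ?G = "star_forest m n g"
  have V: "pverts ?G = {1..n}" by (simp add: star_forest_def symmetric_graph_def)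
  have arcs: "parcs ?G \<subseteq> {1..m} \<times> {m<..n} \<union> {m<..n} \<times> {1..m}"
  proof (rule subrelI)
    fix u v assume "(u, v) \<in> parcs ?G"
    then show "(u, v) \<in> {1..m} \<times> {m<..n} \<union> {m<..n} \<times> {1..m}"
      using funcset_mem[OF g, of u] funcset_mem[OF g, of v] assms(2) unfolding parcs_star_forest by auto
  qed
  then have fin: "finite (parcs ?G)" by (rule finite_subset) auto
  have "pair_graph ?G"
  proof unfold_locales
    show "finite (pverts ?G)" by (simp add: V)
    show "finite (parcs ?G)" by (rule fin)
    show "symmetric (with_proj ?G)" by (auto simp: symmetric_def parcs_star_forest intro!: symI)
    fix e assume e: "e \<in> parcs ?G"
    then have *: "fst e \<in> {1..m} \<and> snd e \<in> {m<..n} \<or> fst e \<in> {m<..n} \<and> snd e \<in> {1..m}"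
      using arcs by auto
    show "fst e \<in> pverts ?G" "snd e \<in> pverts ?G" "fst e \<noteq> snd e"
      using * assms(2) unfolding V by auto
  qed
  then have wf: "pair_wf_digraph ?G" by (rule pair_wf_if_pair_graph)
  have "bipartite_graph ?G"
    unfolding bipartite_graph_def V using assms(2)
    by (intro conjI \<open>pair_graph ?G\<close> exI[of _ "{1..m}"] exI[of _ "{m<..n}"] arcs) auto
  moreover have "induced_free (cycle_graph k) ?G" if "k \<ge> 6" for k
  proof -
    have w: "pair_wf_digraph (cycle_graph k)" using that by (simp add: pair_wf_cycle_graph)
    \<comment> \<open>The edge from 0 to 1, with further neighbours k - 1 and 2, is the forbidden
      configuration.\<close>
    have "(0, 1) \<in> parcs (cycle_graph k)" "(0, k - 1) \<in> parcs (cycle_graph k)"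
      "(1, 2) \<in> parcs (cycle_graph k)"
      using that by (simp_all add: cycle_graph_def)
    then have "\<not> induced_embedding f (cycle_graph k) ?G" for f
      using that by (intro star_forest_no_embedding[OF g w, of 0 1 "k - 1" 2]) simp_all
    then show ?thesis using induced_free_iff[OF wf w] by blast
  qed
  moreover have "induced_free Y_graph ?G"
  proof -
    have "\<not> induced_embedding f Y_graph ?G" for f
      by (rule star_forest_no_embedding[OF g pair_wf_Y_graph, of "Inl 0" "Inl 1" "Inl 3" "Inl 2"])
        (simp_all add: parcs_Y_graph)
    then show ?thesis using induced_free_iff[OF wf pair_wf_Y_graph] by blast
  qed
  ultimately show ?thesis using V by (simp add: labelled_graphs_def chordal_bipartite_def)
qed

text \<open>The only neighbour of a leaf \<open>i\<close> is \<open>g i\<close>, and an extensional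
  function is determined by its values on the leaves.\<close>

lemma inj_on_star_forest: "inj_on (star_forest m n) ({m<..2 * m} \<rightarrow>\<^sub>E {1..m})"
proof (rule inj_onI)
  fix g h assume g: "g \<in> {m<..2 * m} \<rightarrow>\<^sub>E {1..m}" and h: "h \<in> {m<..2 * m} \<rightarrow>\<^sub>E {1..m}"
    and eq: "star_forest m n g = star_forest m n h"
  show "g = h"
  proof (rule PiE_ext[OF g h])
    fix i assume i: "i \<in> {m<..2 * m}"
    then have "(i, g i) \<in> parcs (star_forest m n h)"
      unfolding eq[symmetric] by (simp add: parcs_star_forest)
    moreover have "i \<notin> {1..m}" using i by auto
    ultimately show "g i = h i" using PiE_mem[OF h, of "g i"] unfolding parcs_star_forest by auto
  qed
qed

lemma card_labelled_graphs_ge: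
  assumes "finite (labelled_graphs {G. chordal_bipartite G \<and> induced_free Y_graph G} n)"
  shows "(n div 2) ^ (n div 2) \<le> card (labelled_graphs {G. chordal_bipartite G \<and> induced_free Y_graph G} n)"
proof -
  let ?L = "labelled_graphs {G. chordal_bipartite G \<and> induced_free Y_graph G} n"
  let ?m = "n div 2"
  let ?F = "{?m<..2 * ?m} \<rightarrow>\<^sub>E {1..?m}"
  have "card ?F = ?m ^ ?m" by (simp add: card_PiE)
  moreover have "star_forest ?m n ` ?F \<subseteq> ?L"
    by (intro image_subsetI star_forest_in_class) (auto simp: PiE_def)
  then have "card ?F \<le> card ?L" by (rule card_inj_on_le[OF inj_on_star_forest _ assms])
  ultimately show ?thesis by simp
qed

section \<open>Asymptotics\<close>

lemma log_bigtheta_n_log_n: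
  fixes c :: "nat \<Rightarrow> nat"
  assumes lower: "\<And>n. (n div 2) ^ (n div 2) \<le> c n" and upper: "\<And>n. c n \<le> (4 * n ^ 4) ^ n"
  shows "(\<lambda>n. log 2 (real (c n))) \<in> \<Theta>(\<lambda>n. real n * log 2 (real n))"
proof (rule bigthetaI)
  have ge: "real m * log 2 (real m) \<le> log 2 (real (c n))" if "m = n div 2" "n \<ge> 2" for m n
  proof -
    have "m \<ge> 1" using that by auto
    then have "m ^ m > 0" by simp
    then have "c n > 0" using lower[of n] unfolding that(1) by (rule less_le_trans)
    have "real m * log 2 (real m) = log 2 (real (m ^ m))" using \<open>m \<ge> 1\<close> by (simp add: log_nat_power)
    also have "\<dots> \<le> log 2 (real (c n))"
      using lower[of n] that(1) \<open>m ^ m > 0\<close> \<open>c n > 0\<close>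
      by (subst log_le_cancel_iff) (auto simp del: of_nat_power)
    finally show ?thesis .
  qed
  show "(\<lambda>n. log 2 (real (c n))) \<in> O(\<lambda>n. real n * log 2 (real n))"
  proof (rule landau_o.bigI[of 6])
    show "\<forall>\<^sub>F n in sequentially. norm (log 2 (real (c n))) \<le> 6 * norm (real n * log 2 (real n))"
      using eventually_ge_at_top[of 2]
    proof eventually_elim
      case (elim n)
      have log1: "log 2 (real n) \<ge> 1" using elim by simp
      have "0 \<le> real (n div 2) * log 2 (real (n div 2))"
        using elim by (intro mult_nonneg_nonneg zero_le_log_cancel_iff[THEN iffD2]) auto
      then have nn: "0 \<le> log 2 (real (c n))" using ge[OF refl elim] by linarith
      have "(n div 2) ^ (n div 2) > 0" using elim by simp
      then have "c n > 0" using lower[of n] by (rule less_le_trans)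
      then have "log 2 (real (c n)) \<le> log 2 (real ((4 * n ^ 4) ^ n))"
        using upper[of n] elim by (subst log_le_cancel_iff) (auto simp del: of_nat_power of_nat_mult)
      also have "\<dots> = real n * (2 + 4 * log 2 (real n))"
        using elim log_pow_cancel[of 2 2]
        by (simp add: log_nat_power log_mult distrib_left del: log_pow_cancel)
      \<comment> \<open>As log n \<ge> 1, the summand 2 is at most 2 log n; hence the constant 6 = 2
        + 4.\<close>
      also have "\<dots> \<le> real n * (6 * log 2 (real n))"
        using log1 by (intro mult_left_mono) auto
      finally show ?case using nn log1 by simp
    qed
  qed simp
  show "(\<lambda>n. log 2 (real (c n))) \<in> \<Omega>(\<lambda>n. real n * log 2 (real n))"
  proof (rule landau_omega.bigI[of "1/6"])
    show "\<forall>\<^sub>F n in sequentially. norm (log 2 (real (c n))) \<ge> 1/6 * norm (real n * log 2 (real n))"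
      using eventually_ge_at_top[of 9]
    proof eventually_elim
      case (elim n)
      \<comment> \<open>From n \<ge> 9 follows m \<ge> 4, hence n \<le> 2m + 1 \<le> m^2 and n \<le>
        3m. So n log n \<le> 3m * 2 log m, whence the constant 1/6.\<close>
      define m where "m = n div 2"
      have m: "real n \<le> 3 * real m" "m \<ge> 1" using elim by (auto simp: m_def)
      have "n \<le> m * m"
      proof -
        have "n \<le> 2 * m + 1" "4 \<le> m" using elim by (auto simp: m_def)
        then have "4 * m \<le> m * m" by simp
        then show ?thesis using \<open>n \<le> 2 * m + 1\<close> \<open>4 \<le> m\<close> by linarith
      qed
      then have "real n \<le> real (m ^ 2)" by (simp add: power2_eq_square del: of_nat_mult)
      then have "log 2 (real n) \<le> log 2 (real (m ^ 2))"
        using elim m by (subst log_le_cancel_iff) auto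
      also have "\<dots> = 2 * log 2 (real m)" using m by (simp add: log_nat_power)
      finally have log: "log 2 (real n) \<le> 2 * log 2 (real m)" .
      have pos: "0 \<le> log 2 (real n)" "0 \<le> log 2 (real m)" using elim m by auto
      have "real n * log 2 (real n) \<le> (3 * real m) * (2 * log 2 (real m))"
        using m log pos by (intro mult_mono) auto
      also have "\<dots> \<le> 6 * log 2 (real (c n))" using ge[OF m_def] elim by simp
      finally have "real n * log 2 (real n) \<le> 6 * log 2 (real (c n))" .
      then show ?case using pos by simp
    qed
  qed simp
qed

theorem theorem20:
  shows "factorial_class {G :: nat pair_pre_digraph. chordal_bipartite G \<and> induced_free Y_graph G}"
proof -
  define L where "L = labelled_graphs {G. chordal_bipartite G \<and> induced_free Y_graph G}"
  have sub: "L n \<subseteq> (\<lambda>(A, R). symmetric_graph {1..n} R) ` coded_graphs {1..n}" for n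
    unfolding L_def by (rule labelled_graphs_subset_coded_graphs)
  have fin: "finite (L n)" for n
    by (rule finite_subset[OF sub]) (simp add: finite_coded_graphs)
  have lower: "(n div 2) ^ (n div 2) \<le> card (L n)" for n
    using fin unfolding L_def by (rule card_labelled_graphs_ge)
  have upper: "card (L n) \<le> (4 * n ^ 4) ^ n" for n
  proof -
    have "card (L n) \<le> card (coded_graphs {1..n})"
      by (rule surj_card_le[OF _ sub]) (simp add: finite_coded_graphs)
    also have "\<dots> \<le> (4 * n ^ 4) ^ card {1..n}"
      by (rule card_coded_graphs_le) simp_all
    finally show ?thesis by simp
  qed
  \<comment> \<open>The exponent is the logarithm of the count itself; the equation holds because
    the count is positive.\<close>
  have "\<forall>\<^sub>F n in sequentially. real (card (L n)) = 2 powr log 2 (real (card (L n)))"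
    using eventually_ge_at_top[of 2]
  proof eventually_elim
    case (elim n)
    then have "(n div 2) ^ (n div 2) > 0" by simp
    then have "card (L n) > 0" using lower[of n] by (rule less_le_trans)
    then show ?case by simp
  qed
  then show ?thesis
    unfolding factorial_class_def L_def[symmetric]
    using hereditary_Y_free_chordal_bipartite log_bigtheta_n_log_n[of "\<lambda>n. card (L n)", OF lower upper]
    by blast
qed

end
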